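(* Suppose the standing assumptions on (P) and on the core function $K$ listed in the context hold, that $G+J$ is coercive on $\mathbf U$ if $\mathbf U$ is not bounded (i.e. $u^k\in\mathbf U$, $\|u^k\|\to+\infty$ implies $(G+J)(u^k)\to+\infty$), and that $\{(u^k,p^k)\}$ is generated by VAPP with $0<\underline{\epsilon}\le\epsilon^{k+1}\le\epsilon^k\le\overline{\epsilon}<\beta/(B_G+B_\Omega+\gamma\tau^2)$ for all $k$. Let $(u^*,p^* )$ be a saddle point. With $\bar u_t,\bar p_t,\mathfrak B^u,\mathfrak B^p,r^p,\hat u(\cdot),d_1$ as defined in the context and $$d_2=\max_{(u,p)\in(\mathbf U\cap\mathfrak B^u)\times(\mathbf C^*\cap\mathfrak B^p)}\Big[D(u,u^0)+\frac{\epsilon^0}{2\gamma}\|p-p^0\|^2\Big],$$ for every integer $t\ge0$ we have $(\bar u_t,\bar p_t)\in(\mathbf U\cap\mathfrak B^u)\times(\mathbf C^*\cap\mathfrak B^p)$, $\hat u(\bar p_t)\in\mathbf U\cap\mathfrak B^u$, and: (i) for all $(u,p)\in(\mathbf U\cap\mathfrak B^u)\times(\mathbf C^*\cap\mathfrak B^p)$, $$-\frac{d_2}{\underline{\epsilon}(t+1)}+L(\bar u_t,p)\le L(\bar u_t,\bar p_t)\le L(u,\bar p_t)+\frac{d_2}{\underline{\epsilon}(t+1)};$$ (ii) for all $(u,p)\in(\mathbf U\cap\mathfrak B^u)\times(\mathbf C^*\cap\mathfrak B^p)$, $$-\frac{r^pd_1+d_2}{\underline{\epsilon}(t+1)}-\frac{\gamma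 d_1^2}{2\underline{\epsilon}^2(t+1)^2}+L_\gamma(\bar u_t,p)\le L_\gamma(\bar u_t,\bar p_t)\le L_\gamma(u,\bar p_t)+\frac{r^pd_1+2d_2}{\underline{\epsilon}(t+1)}+\frac{\gamma d_1^2}{2\underline{\epsilon}^2(t+1)^2};$$ (iii) $$\psi_\gamma(p^* )\le\psi_\gamma(\bar p_t)+\frac{2r^pd_1+3d_2}{\underline{\epsilon}(t+1)}+\frac{\gamma d_1^2}{\underline{\epsilon}^2(t+1)^2}.$$
   Context: Norms are Euclidean. $\mathbf U\subset\mathbb R^n$ is a nonempty closed convex set; $\mathbf C\subset\mathbb R^m$ is a nonempty closed convex cone with vertex at the origin; $\mathbf C^*=\{y:\langle y,x\rangle\ge0\ \forall x\in\mathbf C\}$. Problem (P): minimize $G(u)+J(u)$ subject to $\Theta(u)=\Omega(u)+\Phi(u)\in-\mathbf C$, $u\in\mathbf U$, where $\Omega,\Phi$ map into $\mathbb R^m$. Lagrangian: $L(u,p)=(G+J)(u)+\langle p,\Theta(u)\rangle$. A saddle point of $L$ over $\mathbf U\times\mathbf C^*$ is $(u^*,p^* )\in\mathbf U\times\mathbf C^*$ with $L(u^*,p)\le L(u^*,p^* )\le L(u,p^* )$ for all $u\in\mathbf U,p\in\mathbf C^*$. Dual function: $\psi(p)=\min_{u\in\mathbf U}L(u,p)$; the dual problem maximizes $\psi$ over $\mathbf C^*$. $\Pi$ denotes the Euclidean projection onto $\mathbf C^*$. For $\gamma>0$ the augmented Lagrangian is $$L_\gamma(u,p)=\min_{\xi\in-\mathbf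 C}(G+J)(u)+\langle p,\Theta(u)-\xi\rangle+\tfrac\gamma2\|\Theta(u)-\xi\|^2=(G+J)(u)+\tfrac1{2\gamma}\big[\|\Pi(p+\gamma\Theta(u))\|^2-\|p\|^2\big],$$ and $\psi_\gamma(p)=\min_{u\in\mathbf U}L_\gamma(u,p)$ for $p\in\mathbb R^m$. Standing assumptions on (P): (H1) $J$ is a convex l.s.c. function (not necessarily differentiable) with $\operatorname{dom}J\cap\mathbf U\ne\emptyset$. (H2) $G$ is convex and differentiable, with derivative Lipschitz with constant $B_G$. (H3) $\Omega$ and $\Phi$ are $\mathbf C$-convex on $\mathbf U$, where $F$ is $\mathbf C$-convex if $F(\alpha u+(1-\alpha)v)-\alpha F(u)-(1-\alpha)F(v)\in-\mathbf C$ for all $u,v\in\mathbf U$, $\alpha\in[0,1]$. (H4) $\Omega$ is differentiable and for every $p\in\mathbb R^m$ the function $f_p(u)=\langle p,\Omega(u)\rangle$ satisfies $\|\nabla f_p(u)-\nabla f_p(v)\|\le B_\Omega\|u-v\|$ for all $u,v\in\mathbf U$, with $B_\Omega$ independent of $p$. (H5) $\Theta$ is Lipschitz with constant $\tau$ on an open set containing $\mathbf U$. (H6) If the interior $\mathring{\mathbf C}\neq\emptyset$, then $\Theta(\mathbf U)\cap(-\mathring{\mathbf C})\ne\emptyset$; if $\mathbf C=\{0\}$, then $0$ is in the interior of $\Theta(\mathbf U)$. (H7) $L$ has at least one saddle point over $\mathbf U\times\mathbf C^*$. Assumption on the core function: $K$ is strongly convex with parameter $\beta>0$ and differentiable with gradient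 Lipschitz with constant $B$ on $\mathbf U$. Put $D(u,v)=K(u)-K(v)-\langle\nabla K(v),u-v\rangle$. VAPP: fix $\gamma>0$, positive parameters $\epsilon^k$, $u^0\in\mathbf U$, $p^0\in\mathbf C^*$. For $k=0,1,\dots$, with $q^k=\Pi(p^k+\gamma\Theta(u^k))$, set $$u^{k+1}=\arg\min_{u\in\mathbf U}\langle\nabla G(u^k),u\rangle+J(u)+\langle q^k,\nabla\Omega(u^k)u+\Phi(u)\rangle+\tfrac1{\epsilon^k}D(u,u^k),\qquad p^{k+1}=\Pi(p^k+\gamma\Theta(u^{k+1})).$$ Averages: $\bar u_t=\sum_{k=0}^t\epsilon^ku^{k+1}/\sum_{k=0}^t\epsilon^k$, $\bar p_t=\sum_{k=0}^t\epsilon^kq^k/\sum_{k=0}^t\epsilon^k$. Constants: the sequence $\{(u^k,p^k)\}$ is bounded; $\mu>0$ is a number with $\|u^k\|\le\mu$ and $\|p^k\|\le\mu$ for all $k$. Put $r^p=(1+2\gamma\tau)\mu$ and $\mathfrak B^p=\{p:\|p\|\le r^p\}$. Let $d_u>0$ be a constant such that for every $p\in\mathfrak B^p$ there is an optimizer $\hat u(p)\in\arg\min_{u\in\mathbf U}L_\gamma(u,p)$ with $\|\hat u(p)\|\le d_u$ (such a constant exists when (P) satisfies (H1)–(H7) and, in case $\mathbf U$ is not bounded, $G+J$ is coercive on $\mathbf U$, i.e. $u^k\in\mathbf U$, $\|u^k\|\to+\infty$ implies $(G+J)(u^k)\to+\infty$); $\hat u(p)$ denotes such an optimizer. Put $r^u=\max(\mu,d_u)$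 and $\mathfrak B^u=\{u:\|u\|\le r^u\}$. $M_0$ is a bound on the norms of all dual optimal solutions (maximizers of $\psi$ over $\mathbf C^*$), and $d_1=\max_{\|p\|\le M_0+1}\big[D(u^*,u^0)+\frac{\epsilon^0}{2\gamma}\|p-p^0\|^2\big]$. *)

theory Defs
  imports "HOL-Analysis.Analysis"
begin

definition gradient :: "('a::euclidean_space \<Rightarrow> real) \<Rightarrow> 'a \<Rightarrow> 'a"
  where "gradient f x = (THE g. GDERIV f x :> g)"

lemma gderiv_gradient:
  fixes f :: "'a::euclidean_space \<Rightarrow> real"
  assumes "f differentiable (at x)"
  shows "GDERIV f x :> gradient f x"
proof -
  from assms obtain f' where f': "(f has_derivative f') (at x)"
    by (auto simp: differentiable_def)
  then interpret bounded_linear f' by (rule has_derivative_bounded_linear)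
  have "f' h = inner h (adjoint f' 1)" for h
    using adjoint_works[OF linear_axioms, of h 1] by simp
  then have ex: "GDERIV f x :> adjoint f' 1"
    using f' by (simp add: gderiv_def flip: \<open>\<And>h. f' h = _\<close>)
  moreover have "g = adjoint f' 1" if "GDERIV f x :> g" for g
  proof -
    have "(\<lambda>h. inner h g) = (\<lambda>h. inner h (adjoint f' 1))"
      using that ex unfolding gderiv_def by (rule has_derivative_unique)
    then have "inner h g = inner h (adjoint f' 1)" for h by meson
    then show ?thesis using vector_eq_ldot by blast
  qed
  ultimately show ?thesis unfolding gradient_def by (rule theI)
qed

definition bregman :: "('a::euclidean_space \<Rightarrow> real) \<Rightarrow> 'a \<Rightarrow> 'a \<Rightarrow> real"
  where "bregman K u v = K u - K v - inner (gradient K v) (u - v)"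

definition strongly_convex_on :: "'a::real_normed_vector set \<Rightarrow> real \<Rightarrow> ('a \<Rightarrow> real) \<Rightarrow> bool"
  where "strongly_convex_on S \<beta> f \<longleftrightarrow>
    (\<forall>u\<in>S. \<forall>v\<in>S. \<forall>\<alpha>\<in>{0..1}.
      f (\<alpha> *\<^sub>R u + (1 - \<alpha>) *\<^sub>R v)
        \<le> \<alpha> * f u + (1 - \<alpha>) * f v - \<beta> / 2 * \<alpha> * (1 - \<alpha>) * (norm (u - v))\<^sup>2)"

text \<open>
  Convexity and lower semicontinuity for functions on the whole space with values in
  the reals extended by \<open>\<infinity>\<close>.  The value \<open>-\<infinity>\<close> is excluded, so that the right-hand side of
  the convexity inequality is never of the form \<open>\<infinity> - \<infinity>\<close>; recall that \<open>0 * \<infinity> = 0\<close> in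
  \<^typ>\<open>ereal\<close>.
\<close>

definition ext_convex :: "('a::real_vector \<Rightarrow> ereal) \<Rightarrow> bool"
  where "ext_convex f \<longleftrightarrow> (\<forall>x. f x \<noteq> -\<infinity>) \<and>
    (\<forall>x y. \<forall>\<alpha>\<in>{0..1}.
      f (\<alpha> *\<^sub>R x + (1 - \<alpha>) *\<^sub>R y) \<le> ereal \<alpha> * f x + ereal (1 - \<alpha>) * f y)"

definition lsc :: "('a::topological_space \<Rightarrow> ereal) \<Rightarrow> bool"
  where "lsc f \<longleftrightarrow> (\<forall>x. f x \<le> Liminf (at x) f)"

definition dual_cone :: "'a::real_inner set \<Rightarrow> 'a set"
  where "dual_cone C = {y. \<forall>x\<in>C. 0 \<le> inner y x}"

definition cone_convex_on ::
    "'b::real_vector set \<Rightarrow> 'a::real_vector set \<Rightarrow> ('a \<Rightarrow> 'b) \<Rightarrow> bool"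
  where "cone_convex_on C U F \<longleftrightarrow>
    (\<forall>u\<in>U. \<forall>v\<in>U. \<forall>\<alpha>\<in>{0..1}.
      F (\<alpha> *\<^sub>R u + (1 - \<alpha>) *\<^sub>R v) - \<alpha> *\<^sub>R F u - (1 - \<alpha>) *\<^sub>R F v \<in> uminus ` C)"

definition lagrangian ::
    "('a \<Rightarrow> real) \<Rightarrow> ('a \<Rightarrow> ereal) \<Rightarrow> ('a \<Rightarrow> 'b::real_inner) \<Rightarrow> 'a \<Rightarrow> 'b \<Rightarrow> ereal"
  where "lagrangian G J \<Theta> u p = ereal (G u) + J u + ereal (inner p (\<Theta> u))"

definition aug_lagrangian ::
    "'b::real_inner set \<Rightarrow> ('a \<Rightarrow> real) \<Rightarrow> ('a \<Rightarrow> ereal) \<Rightarrow> ('a \<Rightarrow> 'b) \<Rightarrow> real \<Rightarrow> 'a \<Rightarrow> 'b \<Rightarrow> ereal"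
  where "aug_lagrangian C G J \<Theta> \<gamma> u p =
    (INF \<xi>\<in>uminus ` C. ereal (G u) + J u
       + ereal (inner p (\<Theta> u - \<xi>) + \<gamma> / 2 * (norm (\<Theta> u - \<xi>))\<^sup>2))"

definition saddle_point ::
    "'a set \<Rightarrow> 'b set \<Rightarrow> ('a \<Rightarrow> 'b \<Rightarrow> ereal) \<Rightarrow> 'a \<Rightarrow> 'b \<Rightarrow> bool"
  where "saddle_point U P L us ps \<longleftrightarrow> us \<in> U \<and> ps \<in> P \<and>
    (\<forall>u\<in>U. \<forall>p\<in>P. L us p \<le> L us ps \<and> L us ps \<le> L u ps)"

text \<open>
  The infimum need not be attained and may be \<open>-\<infinity>\<close>.
\<close>

definition dual_function :: "'a set \<Rightarrow> ('a \<Rightarrow> 'b \<Rightarrow> ereal) \<Rightarrow> 'b \<Rightarrow> ereal"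
  where "dual_function U L p = (INF u\<in>U. L u p)"

definition vapp_q ::
    "'b::euclidean_space set \<Rightarrow> ('a \<Rightarrow> 'b) \<Rightarrow> real \<Rightarrow> (nat \<Rightarrow> 'a) \<Rightarrow> (nat \<Rightarrow> 'b) \<Rightarrow> nat \<Rightarrow> 'b"
  where "vapp_q C \<Theta> \<gamma> u p k = closest_point (dual_cone C) (p k + \<gamma> *\<^sub>R \<Theta> (u k))"

definition vapp_objective ::
    "('a::euclidean_space \<Rightarrow> real) \<Rightarrow> ('a \<Rightarrow> ereal) \<Rightarrow> ('a \<Rightarrow> 'b::euclidean_space) \<Rightarrow> ('a \<Rightarrow> 'b)
      \<Rightarrow> ('a \<Rightarrow> real) \<Rightarrow> real \<Rightarrow> 'a \<Rightarrow> 'b \<Rightarrow> 'a \<Rightarrow> ereal"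
  where "vapp_objective G J \<Omega> \<Phi> K e uk qk v =
    ereal (inner (gradient G uk) v) + J v
      + ereal (inner qk (frechet_derivative \<Omega> (at uk) v + \<Phi> v))
      + ereal (1 / e * bregman K v uk)"

definition vapp ::
    "'a::euclidean_space set \<Rightarrow> 'b::euclidean_space set \<Rightarrow> ('a \<Rightarrow> real) \<Rightarrow> ('a \<Rightarrow> ereal)
      \<Rightarrow> ('a \<Rightarrow> 'b) \<Rightarrow> ('a \<Rightarrow> 'b) \<Rightarrow> ('a \<Rightarrow> real) \<Rightarrow> real \<Rightarrow> (nat \<Rightarrow> real)
      \<Rightarrow> (nat \<Rightarrow> 'a) \<Rightarrow> (nat \<Rightarrow> 'b) \<Rightarrow> bool"
  where "vapp U C G J \<Omega> \<Phi> K \<gamma> \<epsilon> u p \<longleftrightarrow>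
    u 0 \<in> U \<and> p 0 \<in> dual_cone C \<and>
    (\<forall>k. is_arg_min
           (vapp_objective G J \<Omega> \<Phi> K (\<epsilon> k) (u k) (vapp_q C (\<lambda>v. \<Omega> v + \<Phi> v) \<gamma> u p k))
           (\<lambda>v. v \<in> U) (u (Suc k)) \<and>
         p (Suc k) = closest_point (dual_cone C)
           (p k + \<gamma> *\<^sub>R (\<Omega> (u (Suc k)) + \<Phi> (u (Suc k)))))"

definition weighted_avg :: "(nat \<Rightarrow> real) \<Rightarrow> (nat \<Rightarrow> 'a::real_vector) \<Rightarrow> nat \<Rightarrow> 'a"
  where "weighted_avg \<epsilon> x t = (\<Sum>k\<le>t. \<epsilon> k *\<^sub>R x k) /\<^sub>R (\<Sum>k\<le>t. \<epsilon> k)"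

lemma bipolar_cone:
  fixes C :: "'b::euclidean_space set"
  assumes "convex_cone C" "closed C"
    and w: "\<And>y. y \<in> dual_cone C \<Longrightarrow> 0 \<le> inner y w"
  shows "w \<in> C"
proof (rule ccontr)
  assume "w \<notin> C"
  then obtain a b where ab: "inner a w < b" "\<And>x. x \<in> C \<Longrightarrow> b < inner a x"
    using assms separating_hyperplane_closed_point[of C w] by (auto simp: convex_cone_def)
  have "0 \<in> C" using assms by (metis convex_cone_contains_0)
  then have b: "b < 0" using ab(2) by fastforce
  have "0 \<le> inner a x" if x: "x \<in> C" for x
  proof (rule ccontr)
    assume "\<not> 0 \<le> inner a x"
    then have neg: "inner a x < 0" by simp
    with b have c: "0 \<le> b / inner a x" by (simp add: divide_nonpos_neg)
    then have "(b / inner a x) *\<^sub>R x \<in> C"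
      using assms x by (auto simp: convex_cone_def conic_def)
    from ab(2)[OF this] neg show False by simp
  qed
  then have "a \<in> dual_cone C" by (simp add: dual_cone_def)
  from w[OF this] ab(1) b show False by simp
qed

lemma aug_lagrangian_closed_form:
  fixes C :: "'b::euclidean_space set"
  assumes C: "convex_cone C" "closed C" and \<gamma>: "0 < \<gamma>"
  shows "aug_lagrangian C G J \<Theta> \<gamma> u p = ereal (G u) + J u
    + ereal (1 / (2 * \<gamma>)
        * ((norm (closest_point (dual_cone C) (p + \<gamma> *\<^sub>R \<Theta> u)))\<^sup>2 - (norm p)\<^sup>2))"
proof -
  let ?D = "dual_cone C"
  define y where "y = p + \<gamma> *\<^sub>R \<Theta> u"
  define z where "z = closest_point ?D y"
  define f where "f = (\<lambda>\<xi>. inner p (\<Theta> u - \<xi>) + \<gamma> / 2 * (norm (\<Theta> u - \<xi>))\<^sup>2)"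
  have D: "closed ?D" "convex ?D" "?D \<noteq> {}"
  proof -
    have eq: "?D = (\<Inter>x\<in>C. {y. 0 \<le> inner x y})"
      by (auto simp: dual_cone_def inner_commute)
    show "closed ?D" unfolding eq by (intro closed_INT ballI closed_halfspace_ge)
    show "convex ?D"
      by (auto simp: dual_cone_def convex_def inner_add_left)
    have "0 \<in> ?D" by (simp add: dual_cone_def)
    then show "?D \<noteq> {}" by blast
  qed
  have zD: "z \<in> ?D" unfolding z_def using D closest_point_in_set by blast
  have cD: "c *\<^sub>R x \<in> ?D" if "x \<in> ?D" "0 \<le> c" for c x
    using that by (auto simp: dual_cone_def)
  have proj: "inner (y - z) (x - z) \<le> 0" if "x \<in> ?D" for x
    unfolding z_def using closest_point_dot[OF D(2,1) that] .
  have orth: "inner (y - z) z = 0"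
    using proj[OF cD[OF zD, of 0]] proj[OF cD[OF zD, of 2]]
    by (simp add: inner_diff_right scaleR_2 inner_add_right)
  have "z - y \<in> C"
  proof (rule bipolar_cone[OF C])
    fix x assume "x \<in> ?D"
    from proj[OF this] orth show "0 \<le> inner x (z - y)"
      by (simp add: inner_diff_right inner_diff_left inner_commute)
  qed
  moreover have "\<And>c x. x \<in> C \<Longrightarrow> 0 \<le> c \<Longrightarrow> c *\<^sub>R x \<in> C"
    using C by (auto simp: convex_cone_def conic_def)
  ultimately have xi: "(1 / \<gamma>) *\<^sub>R (z - y) \<in> C" using \<gamma> by simp
  have f: "f \<xi> = 1 / (2 * \<gamma>) * ((norm (y - \<gamma> *\<^sub>R \<xi>))\<^sup>2 - (norm p)\<^sup>2)" for \<xi>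
  proof -
    have "y - \<gamma> *\<^sub>R \<xi> = p + \<gamma> *\<^sub>R (\<Theta> u - \<xi>)" by (simp add: y_def algebra_simps)
    moreover have "(norm (p + \<gamma> *\<^sub>R x))\<^sup>2 = (norm p)\<^sup>2 + 2 * \<gamma> * inner p x + \<gamma>\<^sup>2 * (norm x)\<^sup>2" for x
      unfolding power2_norm_eq_inner
      by (simp add: inner_add_left inner_add_right inner_commute power2_eq_square)
    ultimately have "(norm (y - \<gamma> *\<^sub>R \<xi>))\<^sup>2
        = (norm p)\<^sup>2 + 2 * \<gamma> * inner p (\<Theta> u - \<xi>) + \<gamma>\<^sup>2 * (norm (\<Theta> u - \<xi>))\<^sup>2"
      by metis
    then show ?thesis using \<gamma> by (simp add: f_def field_simps power2_eq_square)
  qed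
  let ?m = "1 / (2 * \<gamma>) * ((norm z)\<^sup>2 - (norm p)\<^sup>2)"
  have lower: "?m \<le> f \<xi>" if "\<xi> \<in> uminus ` C" for \<xi>
  proof -
    from that obtain c where c: "c \<in> C" "\<xi> = - c" by blast
    have "0 \<le> inner z c" using zD c by (simp add: dual_cone_def)
    then have "(norm z)\<^sup>2 \<le> inner (y - \<gamma> *\<^sub>R \<xi>) z"
      using orth \<gamma> c(2)
      by (simp add: inner_diff_left inner_diff_right inner_add_left inner_add_right
          inner_commute power2_norm_eq_inner)
    also have "\<dots> \<le> norm (y - \<gamma> *\<^sub>R \<xi>) * norm z" by (rule norm_cauchy_schwarz)
    finally have "norm z * norm z \<le> norm (y - \<gamma> *\<^sub>R \<xi>) * norm z"
      by (simp add: power2_eq_square)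
    then have "norm z \<le> norm (y - \<gamma> *\<^sub>R \<xi>)"
      by (cases "norm z = 0") (use norm_ge_zero in \<open>simp_all add: mult_le_cancel_right\<close>)
    then have "(norm z)\<^sup>2 \<le> (norm (y - \<gamma> *\<^sub>R \<xi>))\<^sup>2" by (intro power_mono) auto
    then show ?thesis unfolding f using \<gamma> by (intro mult_left_mono) auto
  qed
  have attained: "f (- ((1 / \<gamma>) *\<^sub>R (z - y))) = ?m"
    unfolding f using \<gamma> by simp
  have "aug_lagrangian C G J \<Theta> \<gamma> u p = (INF \<xi>\<in>uminus ` C. ereal (G u) + J u + ereal (f \<xi>))"
    by (simp add: aug_lagrangian_def f_def)
  also have "\<dots> = ereal (G u) + J u + ereal ?m"
  proof (rule antisym)
    have "(INF \<xi>\<in>uminus ` C. ereal (G u) + J u + ereal (f \<xi>))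
        \<le> ereal (G u) + J u + ereal (f (- ((1 / \<gamma>) *\<^sub>R (z - y))))"
      by (rule INF_lower) (use xi in blast)
    then show "(INF \<xi>\<in>uminus ` C. ereal (G u) + J u + ereal (f \<xi>))
        \<le> ereal (G u) + J u + ereal ?m"
      by (simp only: attained)
    show "ereal (G u) + J u + ereal ?m
        \<le> (INF \<xi>\<in>uminus ` C. ereal (G u) + J u + ereal (f \<xi>))"
      by (intro INF_greatest add_left_mono) (use lower in simp)
  qed
  finally show ?thesis by (simp add: z_def y_def)
qed

end

theory Submission
  imports Defs "HOL-Real_Asymp.Real_Asymp"
begin

text \<open>
  The rate rests on one estimate for the ergodic averages.  With
  \<open>\<Delta> v y = D(v, u\<^sub>0) + \<epsilon>\<^sub>0/(2\<gamma>) \<parallel>y - p\<^sub>0\<parallel>\<^sup>2\<close>, every \<open>v \<in> U\<close> and \<open>y\<close> in the dual cone satisfy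
  \<open>L(ubar\<^sub>t, y) - L(v, pbar\<^sub>t) \<le> \<Delta> v y / (\<epsilon>low (t + 1))\<close> (lemma \<open>ergodic_gap\<close>).

  One iteration contributes two inequalities.  The primal update is a Bregman proximal step on
  a linearization; its optimality condition, the three-point identity and the descent lemma
  for the smooth part bound \<open>L(u\<^sub>k\<^sub>+\<^sub>1, q\<^sub>k) - L(v, q\<^sub>k)\<close> by a difference of Bregman distances minus a multiple of \<open>\<parallel>u\<^sub>k\<^sub>+\<^sub>1 - u\<^sub>k\<parallel>\<^sup>2\<close>
  (\<open>primal_step\<close>).  The pair \<open>q\<^sub>k, p\<^sub>k\<^sub>+\<^sub>1\<close> is a predictor-corrector (extragradient) step in the
  multiplier, which bounds \<open>L(u\<^sub>k\<^sub>+\<^sub>1, y) - L(u\<^sub>k\<^sub>+\<^sub>1, q\<^sub>k)\<close> by a difference of squared distances plus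
  \<open>\<gamma>\<tau>\<^sup>2/2 \<parallel>u\<^sub>k\<^sub>+\<^sub>1 - u\<^sub>k\<parallel>\<^sup>2\<close> (\<open>predictor_corrector_dual_step\<close>).  The step size bound says exactly that
  the strong convexity of \<open>K\<close> absorbs all terms in \<open>\<parallel>u\<^sub>k\<^sub>+\<^sub>1 - u\<^sub>k\<parallel>\<^sup>2\<close>.  Summing telescopes, because the
  \<open>\<epsilon>\<^sub>k\<close> decrease, and convexity of \<open>L\<close> in \<open>u\<close> and linearity in \<open>p\<close> pass to the averages.

  Part (i) is the estimate with \<open>v = ubar\<^sub>t\<close> or \<open>y = pbar\<^sub>t\<close>.

  For part (ii), test the estimate at \<open>v = us\<close> and at \<open>ps\<close> moved by a unit vector
  in the direction of \<open>\<Pi>(\<Theta>(ubar\<^sub>t))\<close>.  The saddle point inequalities cancel everything except the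
  norm of that projection, so the constraint violation of \<open>ubar\<^sub>t\<close> is at most
  \<open>a = d\<^sub>1/(\<epsilon>low (t + 1))\<close> (\<open>infeasibility_le_gap\<close>).  On the dual cone \<open>L \<le> L\<^sub>\<gamma>\<close>, while \<open>L\<^sub>\<gamma>\<close> exceeds the
  objective at \<open>ubar\<^sub>t\<close> by at most \<open>r\<^sub>p a + \<gamma>/2 a\<^sup>2\<close>; so (i) transfers to \<open>L\<^sub>\<gamma>\<close> up to this error.

  For part (iii), the given multiplier \<open>ps\<close> may lie outside the ball of radius \<open>r\<^sub>p\<close> in which (ii)
  holds.  A cluster point of the averages \<open>pbar\<^sub>t\<close> lies in the ball, and passing to the limit in the
  estimate shows that it is optimal for the dual problem too
  (\<open>bounded_dual_solution\<close>).  The optimal value bounds \<open>\<psi>\<^sub>\<gamma>(ps)\<close>, is at most \<open>L(ubar\<^sub>t, \<cdot>)\<close> at that cluster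
  point, and (i) compares this with \<open>L\<close>, hence with \<open>L\<^sub>\<gamma>\<close>, at a minimizer of \<open>L\<^sub>\<gamma>(\<cdot>, pbar\<^sub>t)\<close>.
\<close>

section \<open>Projections onto a dual cone\<close>

lemma dual_cone_closed: "closed (dual_cone C)"
proof -
  have "dual_cone C = (\<Inter>x\<in>C. {y. 0 \<le> inner x y})"
    by (auto simp: dual_cone_def inner_commute)
  then show ?thesis by (metis closed_INT closed_halfspace_ge)
qed

lemma dual_cone_convex: "convex (dual_cone C)"
  by (auto simp: dual_cone_def convex_def inner_add_left)

lemma zero_in_dual_cone: "0 \<in> dual_cone C"
  by (simp add: dual_cone_def)

lemma dual_cone_add: "x \<in> dual_cone C \<Longrightarrow> y \<in> dual_cone C \<Longrightarrow> x + y \<in> dual_cone C"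
  by (simp add: dual_cone_def inner_add_left)

lemma dual_cone_scaleR: "x \<in> dual_cone C \<Longrightarrow> 0 \<le> c \<Longrightarrow> c *\<^sub>R x \<in> dual_cone C"
  by (simp add: dual_cone_def)

lemma projection_in_dual_cone:
  fixes C :: "'b::euclidean_space set"
  shows "closest_point (dual_cone C) x \<in> dual_cone C"
  using closest_point_in_set[OF dual_cone_closed] zero_in_dual_cone by blast

lemma projection_variational_inequality:
  fixes C :: "'b::euclidean_space set"
  assumes "y \<in> dual_cone C"
  shows "inner (x - closest_point (dual_cone C) x) (y - closest_point (dual_cone C) x) \<le> 0"
  using closest_point_dot[OF dual_cone_convex dual_cone_closed assms] .

lemma projection_dual_cone_nonexpansive:
  fixes C :: "'b::euclidean_space set"
  shows "norm (closest_point (dual_cone C) x - closest_point (dual_cone C) y) \<le> norm (x - y)"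
  using closest_point_lipschitz[OF dual_cone_convex dual_cone_closed] zero_in_dual_cone
  by (metis dist_norm empty_iff)

text \<open>
  The variational inequality at the multiples \<open>0\<close> and \<open>2\<close> of the projection: the residual
  is orthogonal to the projection because the cone is closed under scaling.
\<close>

lemma inner_projection_dual_cone:
  fixes C :: "'b::euclidean_space set"
  shows "inner (closest_point (dual_cone C) x) x = (norm (closest_point (dual_cone C) x))\<^sup>2"
proof -
  let ?z = "closest_point (dual_cone C) x"
  have "0 *\<^sub>R ?z \<in> dual_cone C" "2 *\<^sub>R ?z \<in> dual_cone C"
    by (intro dual_cone_scaleR projection_in_dual_cone; simp)+
  from this[THEN projection_variational_inequality, of x] show ?thesis
    by (simp add: inner_diff_right inner_diff_left inner_commute power2_norm_eq_inner)
qed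

text \<open>
  The other half of the Moreau decomposition: the residual lies in the polar of the dual cone,
  and the bipolar theorem identifies that polar with \<open>- C\<close>.
\<close>

lemma projection_minus_point_in_cone:
  fixes C :: "'b::euclidean_space set"
  assumes "convex_cone C" "closed C"
  shows "closest_point (dual_cone C) x - x \<in> C"
proof (rule bipolar_cone[OF assms])
  let ?z = "closest_point (dual_cone C) x"
  fix y assume "y \<in> dual_cone C"
  from projection_variational_inequality[OF this, of x] inner_projection_dual_cone[of C x]
  show "0 \<le> inner y (?z - x)"
    by (simp add: inner_diff_right inner_diff_left inner_commute power2_norm_eq_inner)
qed

text \<open>
  The extragradient inequality.  Test the projection \<open>p'\<close> against \<open>y\<close> and the projection
  \<open>q\<close> against \<open>p'\<close>; what remains is the cross term \<open>2 \<gamma> \<langle>p' - q, b - a\<rangle>\<close>, and completing the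
  square against \<open>\<parallel>p' - q\<parallel>\<^sup>2\<close> leaves only \<open>\<gamma>\<^sup>2 \<parallel>b - a\<parallel>\<^sup>2\<close>.
\<close>

lemma predictor_corrector_dual_step:
  fixes C :: "'b::euclidean_space set"
  assumes y: "y \<in> dual_cone C" and "0 < \<gamma>"
    and q: "q = closest_point (dual_cone C) (p + \<gamma> *\<^sub>R a)"
    and p': "p' = closest_point (dual_cone C) (p + \<gamma> *\<^sub>R b)"
  shows "inner (y - q) b
    \<le> 1 / (2 * \<gamma>) * ((norm (y - p))\<^sup>2 - (norm (y - p'))\<^sup>2) + \<gamma> / 2 * (norm (b - a))\<^sup>2"
proof -
  have p'D: "p' \<in> dual_cone C" unfolding p' by (rule projection_in_dual_cone)
  have 1: "inner (p + \<gamma> *\<^sub>R b - p') (y - p') \<le> 0"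
    unfolding p' by (rule projection_variational_inequality[OF y])
  have 2: "inner (p + \<gamma> *\<^sub>R a - q) (p' - q) \<le> 0"
    unfolding q by (rule projection_variational_inequality[OF p'D])
  have 3: "0 \<le> inner (p' - q - \<gamma> *\<^sub>R (b - a)) (p' - q - \<gamma> *\<^sub>R (b - a))"
    by simp
  have 4: "0 \<le> inner (q - p) (q - p)" by simp
  from 1 2 3 4 have "2 * \<gamma> * inner (y - q) b
      \<le> (norm (y - p))\<^sup>2 - (norm (y - p'))\<^sup>2 + \<gamma> * \<gamma> * (norm (b - a))\<^sup>2"
    unfolding power2_norm_eq_inner
    by (simp add: inner_diff_right inner_diff_left inner_add_left inner_add_right
        inner_commute algebra_simps)
  with \<open>0 < \<gamma>\<close> show ?thesis by (simp add: field_simps)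
qed

section \<open>Gradients, Bregman distances and the proximal step\<close>

lemma gderiv_imp_gradient_eq:
  fixes f :: "'a::euclidean_space \<Rightarrow> real"
  assumes "GDERIV f x :> g"
  shows "gradient f x = g"
proof -
  have "f differentiable (at x)"
    using assms by (auto simp: gderiv_def differentiable_def)
  from gderiv_gradient[OF this] assms have "(\<lambda>h. inner h (gradient f x)) = (\<lambda>h. inner h g)"
    unfolding gderiv_def by (rule has_derivative_unique)
  then show ?thesis by (metis vector_eq_ldot)
qed

lemma gradient_add:
  fixes f g :: "'a::euclidean_space \<Rightarrow> real"
  assumes "f differentiable (at x)" "g differentiable (at x)"
  shows "gradient (\<lambda>v. f v + g v) x = gradient f x + gradient g x"
  using assms by (intro gderiv_imp_gradient_eq GDERIV_add gderiv_gradient)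

lemma inner_frechet_derivative_eq_gradient:
  fixes F :: "'a::euclidean_space \<Rightarrow> 'b::euclidean_space"
  assumes "F differentiable (at x)"
  shows "inner y (frechet_derivative F (at x) v) = inner (gradient (\<lambda>v. inner y (F v)) x) v"
proof -
  have "((\<lambda>v. inner y (F v)) has_derivative (\<lambda>h. inner y (frechet_derivative F (at x) h))) (at x)"
    using assms by (intro has_derivative_inner_right) (simp add: frechet_derivative_works)
  moreover from this have "(\<lambda>v. inner y (F v)) differentiable (at x)"
    by (auto simp: differentiable_def)
  from gderiv_gradient[OF this]
  have "((\<lambda>v. inner y (F v)) has_derivative (\<lambda>h. inner h (gradient (\<lambda>v. inner y (F v)) x))) (at x)"
    by (simp add: gderiv_def)
  ultimately show ?thesis by (metis has_derivative_unique inner_commute)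
qed

lemma line_derivative:
  fixes f :: "'a::euclidean_space \<Rightarrow> real"
  assumes "f differentiable (at (x + s *\<^sub>R d))"
  shows "((\<lambda>s. f (x + s *\<^sub>R d)) has_real_derivative inner (gradient f (x + s *\<^sub>R d)) d) (at s)"
proof -
  have "(f has_derivative (\<lambda>h. inner h (gradient f (x + s *\<^sub>R d)))) (at (x + s *\<^sub>R d))"
    using gderiv_gradient[OF assms] by (simp add: gderiv_def)
  moreover have "((\<lambda>s. x + s *\<^sub>R d) has_derivative (\<lambda>h. h *\<^sub>R d)) (at s)"
    by (auto intro!: derivative_eq_intros)
  ultimately have "((\<lambda>s. f (x + s *\<^sub>R d)) has_derivative
      (\<lambda>h. inner (h *\<^sub>R d) (gradient f (x + s *\<^sub>R d)))) (at s)"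
    by (rule has_derivative_compose[rotated])
  moreover have "inner (h *\<^sub>R d) g = inner g d * h" for h g
    by (simp add: inner_commute)
  ultimately show ?thesis
    by (simp only: has_field_derivative_def)
qed

lemma difference_quotient_tendsto_gradient:
  fixes f :: "'a::euclidean_space \<Rightarrow> real"
  assumes "f differentiable (at x)"
  shows "((\<lambda>s. (f (x + s *\<^sub>R d) - f x) / s) \<longlongrightarrow> inner (gradient f x) d) (at_right 0)"
proof -
  have "((\<lambda>s. (f (x + s *\<^sub>R d) - f x) / s) \<longlongrightarrow> inner (gradient f x) d) (at 0)"
    using line_derivative[of f x 0 d] assms by (simp add: DERIV_def)
  then show ?thesis by (rule tendsto_within_subset) simp
qed

text \<open>
  Divide the strong convexity inequality on the segment from \<open>x\<close> to \<open>y\<close> by the step \<open>s\<close>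
  and let \<open>s\<close> tend to \<open>0\<close> from the right.
\<close>

lemma strongly_convex_bregman_lower_bound:
  fixes f :: "'a::euclidean_space \<Rightarrow> real"
  assumes f: "strongly_convex_on S \<beta> f" and x: "x \<in> S" and y: "y \<in> S"
    and d: "f differentiable (at x)"
  shows "\<beta> / 2 * (norm (y - x))\<^sup>2 \<le> bregman f y x"
proof -
  have "inner (gradient f x) (y - x) \<le> f y - f x - \<beta> / 2 * (1 - 0) * (norm (y - x))\<^sup>2"
  proof (rule tendsto_le)
    show "at_right (0::real) \<noteq> bot" by simp
    show "((\<lambda>s. f y - f x - \<beta> / 2 * (1 - s) * (norm (y - x))\<^sup>2)
        \<longlongrightarrow> f y - f x - \<beta> / 2 * (1 - 0) * (norm (y - x))\<^sup>2) (at_right 0)"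
      by (intro tendsto_intros)
    show "((\<lambda>s. (f (x + s *\<^sub>R (y - x)) - f x) / s) \<longlongrightarrow> inner (gradient f x) (y - x)) (at_right 0)"
      by (rule difference_quotient_tendsto_gradient[OF d])
    have "(f (x + s *\<^sub>R (y - x)) - f x) / s \<le> f y - f x - \<beta> / 2 * (1 - s) * (norm (y - x))\<^sup>2"
      if "0 < s" "s < 1" for s
    proof -
      have "f (s *\<^sub>R y + (1 - s) *\<^sub>R x)
          \<le> s * f y + (1 - s) * f x - \<beta> / 2 * s * (1 - s) * (norm (y - x))\<^sup>2"
        using f x y that unfolding strongly_convex_on_def by auto
      moreover have "s *\<^sub>R y + (1 - s) *\<^sub>R x = x + s *\<^sub>R (y - x)" by (simp add: algebra_simps)
      ultimately show ?thesis using that by (simp add: field_simps)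
    qed
    then show "\<forall>\<^sub>F s in at_right 0. (f (x + s *\<^sub>R (y - x)) - f x) / s
        \<le> f y - f x - \<beta> / 2 * (1 - s) * (norm (y - x))\<^sup>2"
      unfolding eventually_at_right_field by (intro exI[of _ 1]) auto
  qed
  then show ?thesis by (simp add: bregman_def)
qed

lemma convex_on_bregman_nonneg:
  fixes f :: "'a::euclidean_space \<Rightarrow> real"
  assumes "convex_on S f" "x \<in> S" "y \<in> S" "f differentiable (at x)"
  shows "0 \<le> bregman f y x"
proof -
  have "strongly_convex_on S 0 f"
    using assms(1) by (auto simp: strongly_convex_on_def convex_on_alt)
  from strongly_convex_bregman_lower_bound[OF this assms(2-4)] show ?thesis by simp
qed

text \<open>
  The descent lemma.  Along the segment, the difference of \<open>f\<close> and its quadratic model has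
  nonpositive derivative, since the gradient grows at most linearly.
\<close>

lemma bregman_le_of_lipschitz_gradient:
  fixes f :: "'a::euclidean_space \<Rightarrow> real"
  assumes S: "convex S" and x: "x \<in> S" and y: "y \<in> S"
    and d: "\<And>z. z \<in> S \<Longrightarrow> f differentiable (at z)" and B: "B-lipschitz_on S (gradient f)"
  shows "bregman f y x \<le> B / 2 * (norm (y - x))\<^sup>2"
proof -
  let ?d = "y - x"
  define \<phi> where "\<phi> s = f (x + s *\<^sub>R ?d) - s * inner (gradient f x) ?d - B / 2 * s\<^sup>2 * (norm ?d)\<^sup>2" for s
  have inS: "x + s *\<^sub>R ?d \<in> S" if "0 \<le> s" "s \<le> 1" for s
  proof -
    have "(1 - s) *\<^sub>R x + s *\<^sub>R y \<in> S" using S x y that by (auto simp: convex_alt)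
    moreover have "(1 - s) *\<^sub>R x + s *\<^sub>R y = x + s *\<^sub>R ?d" by (simp add: algebra_simps)
    ultimately show ?thesis by simp
  qed
  have "\<phi> 1 \<le> \<phi> 0"
  proof (rule DERIV_nonpos_imp_nonincreasing[where f = \<phi>])
    fix s :: real assume s: "0 \<le> s" "s \<le> 1"
    let ?l = "inner (gradient f (x + s *\<^sub>R ?d)) ?d - inner (gradient f x) ?d
        - B * s * (norm ?d)\<^sup>2"
    have der: "(\<phi> has_real_derivative ?l) (at s)"
      unfolding \<phi>_def using line_derivative[OF d[OF inS[OF s]]]
      by (auto intro!: derivative_eq_intros)
    have "inner (gradient f (x + s *\<^sub>R ?d)) ?d - inner (gradient f x) ?d \<le> B * s * (norm ?d)\<^sup>2"
    proof -
      have "inner (gradient f (x + s *\<^sub>R ?d) - gradient f x) ?d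
          \<le> norm (gradient f (x + s *\<^sub>R ?d) - gradient f x) * norm ?d"
        by (rule norm_cauchy_schwarz)
      also have "\<dots> \<le> (B * norm (s *\<^sub>R ?d)) * norm ?d"
        using lipschitz_onD[OF B inS[OF s] x] by (intro mult_right_mono) (simp_all add: dist_norm)
      finally show ?thesis using s by (simp add: inner_diff_left power2_eq_square)
    qed
    then have "?l \<le> 0" by simp
    with der show "\<exists>l. (\<phi> has_real_derivative l) (at s) \<and> l \<le> 0" by blast
  qed simp
  then show ?thesis by (simp add: \<phi>_def bregman_def)
qed

lemma bregman_three_point:
  "inner (gradient K x - gradient K z) (v - x) = bregman K v z - bregman K v x - bregman K x z"
  by (simp add: bregman_def inner_diff_left inner_diff_right)

text \<open>
  The minimality of \<open>x\<close> is compared with the points \<open>x + s (v - x)\<close>: convexity of \<open>c\<close> makes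
  its decrease at least proportional to \<open>s\<close>, and the difference quotient of the Bregman term tends to
  the left-hand side of the three-point identity.  No derivative of \<open>c\<close> enters.
\<close>

lemma bregman_proximal_inequality:
  fixes K :: "'a::euclidean_space \<Rightarrow> real"
  assumes c: "convex_on S c" and x: "x \<in> S" and v: "v \<in> S"
    and d: "K differentiable (at x)" and e: "0 < e"
    and min: "\<And>w. w \<in> S \<Longrightarrow> c x + 1 / e * bregman K x z \<le> c w + 1 / e * bregman K w z"
  shows "e * (c x - c v) \<le> bregman K v z - bregman K v x - bregman K x z"
proof -
  let ?d = "v - x"
  have "e * (c x - c v) \<le> inner (gradient K x) ?d - inner (gradient K z) ?d"
  proof (rule tendsto_lowerbound)
    show "at_right (0::real) \<noteq> bot" by simp
    show "((\<lambda>s. (K (x + s *\<^sub>R ?d) - K x) / s - inner (gradient K z) ?d)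
        \<longlongrightarrow> inner (gradient K x) ?d - inner (gradient K z) ?d) (at_right 0)"
      by (intro tendsto_intros difference_quotient_tendsto_gradient[OF d])
    have "e * (c x - c v) \<le> (K (x + s *\<^sub>R ?d) - K x) / s - inner (gradient K z) ?d"
      if s: "0 < s" "s < 1" for s
    proof -
      have eq: "(1 - s) *\<^sub>R x + s *\<^sub>R v = x + s *\<^sub>R ?d" by (simp add: algebra_simps)
      have "(1 - s) *\<^sub>R x + s *\<^sub>R v \<in> S"
        using convex_on_imp_convex[OF c] x v s by (auto simp: convex_alt)
      with eq have wS: "x + s *\<^sub>R ?d \<in> S" by simp
      have "c ((1 - s) *\<^sub>R x + s *\<^sub>R v) \<le> (1 - s) * c x + s * c v"
        using c x v s by (intro convex_onD) auto
      with eq have "c (x + s *\<^sub>R ?d) \<le> c x - s * (c x - c v)" by (simp add: algebra_simps)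
      with min[OF wS] have "s * (c x - c v) \<le> 1 / e * (bregman K (x + s *\<^sub>R ?d) z - bregman K x z)"
        by (simp add: algebra_simps)
      also have "bregman K (x + s *\<^sub>R ?d) z - bregman K x z
          = K (x + s *\<^sub>R ?d) - K x - s * inner (gradient K z) ?d"
        by (simp add: bregman_def inner_diff_right inner_add_right algebra_simps)
      finally show ?thesis using s e by (simp add: field_simps)
    qed
    then show "\<forall>\<^sub>F s in at_right 0. e * (c x - c v)
        \<le> (K (x + s *\<^sub>R ?d) - K x) / s - inner (gradient K z) ?d"
      unfolding eventually_at_right_field by (intro exI[of _ 1]) auto
  qed
  then show ?thesis using bregman_three_point[of K x z v] by (simp add: inner_diff_left)
qed

text \<open>
  Linearizing \<open>f\<close> at \<open>x\<close> costs nothing at \<open>v\<close>, where convexity puts \<open>f\<close> above its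
  tangent, and at most \<open>B/2 \<parallel>x' - x\<parallel>\<^sup>2\<close> at \<open>x'\<close> by the descent lemma; the strongly convex term
  \<open>bregman K x' x\<close> left over from the proximal inequality pays for it.  The larger set \<open>T\<close> is
  there because the centre \<open>x\<close> may be outside the domain \<open>S\<close> of \<open>h\<close>, as the starting
  point of the algorithm can be.
\<close>

lemma linearized_bregman_step:
  fixes f h K :: "'a::euclidean_space \<Rightarrow> real"
  assumes T: "S \<subseteq> T"
    and f: "convex_on T f" "\<And>w. w \<in> T \<Longrightarrow> f differentiable (at w)" "B-lipschitz_on T (gradient f)"
    and h: "convex_on S h"
    and K: "strongly_convex_on T \<beta> K" "\<And>w. w \<in> T \<Longrightarrow> K differentiable (at w)"
    and x: "x \<in> T" and x': "x' \<in> S" and v: "v \<in> S" and e: "0 < e"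
    and min: "\<And>w. w \<in> S \<Longrightarrow> inner (gradient f x) x' + h x' + 1 / e * bregman K x' x
        \<le> inner (gradient f x) w + h w + 1 / e * bregman K w x"
  shows "e * (f x' + h x' - (f v + h v))
    \<le> bregman K v x - bregman K v x' - (\<beta> - e * B) / 2 * (norm (x' - x))\<^sup>2"
proof -
  have S: "convex S" using h by (rule convex_on_imp_convex)
  have "convex_on S (\<lambda>w. inner (gradient f x) w + h w)"
    using S h by (intro convex_on_add) (auto simp: convex_on_def inner_add_right)
  from bregman_proximal_inequality[OF this x' v K(2) e min]
  have prox: "e * (inner (gradient f x) x' + h x' - (inner (gradient f x) v + h v))
      \<le> bregman K v x - bregman K v x' - bregman K x' x"
    using T x' by auto
  have "0 \<le> bregman f v x"
    using T v by (intro convex_on_bregman_nonneg[OF f(1) x _ f(2)[OF x]]) auto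
  moreover have "bregman f x' x \<le> B / 2 * (norm (x' - x))\<^sup>2"
    using T x' by (intro bregman_le_of_lipschitz_gradient[OF convex_on_imp_convex[OF f(1)] x _ f(2,3)]) auto
  ultimately have "f x' - f v \<le> inner (gradient f x) x' - inner (gradient f x) v
      + B / 2 * (norm (x' - x))\<^sup>2"
    by (simp add: bregman_def inner_diff_right)
  then have "e * (f x' - f v) \<le> e * (inner (gradient f x) x' - inner (gradient f x) v
      + B / 2 * (norm (x' - x))\<^sup>2)"
    using e by (intro mult_left_mono) auto
  moreover have "\<beta> / 2 * (norm (x' - x))\<^sup>2 \<le> bregman K x' x"
    using T x' by (intro strongly_convex_bregman_lower_bound[OF K(1) x _ K(2)[OF x]]) auto
  ultimately show ?thesis using prox by (simp add: algebra_simps diff_divide_distrib)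
qed

section \<open>Weighted averages\<close>

lemma weighted_avg_as_convex_combination:
  "weighted_avg w x t = (\<Sum>k\<le>t. (w k / (\<Sum>k\<le>t. w k)) *\<^sub>R x k)"
  by (simp add: weighted_avg_def scaleR_sum_right divide_inverse mult.commute)

lemma weighted_avg_in_convex:
  assumes "convex S" and "\<And>k. 0 < w k" and "\<And>k. x k \<in> S"
  shows "weighted_avg w x t \<in> S"
proof -
  have "0 < (\<Sum>k\<le>t. w k)" using assms(2) by (intro sum_pos) auto
  then show ?thesis
    unfolding weighted_avg_as_convex_combination using assms
    by (intro convex_sum) (auto simp: less_imp_le simp flip: sum_divide_distrib)
qed

lemma convex_on_weighted_avg:
  fixes f :: "'a::real_vector \<Rightarrow> real"
  assumes "convex_on S f" and "\<And>k. 0 < w k" and "\<And>k. x k \<in> S"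
  shows "(\<Sum>k\<le>t. w k) * f (weighted_avg w x t) \<le> (\<Sum>k\<le>t. w k * f (x k))"
proof -
  let ?W = "\<Sum>k\<le>t. w k"
  have W: "0 < ?W" using assms(2) by (intro sum_pos) auto
  have "f (weighted_avg w x t) \<le> (\<Sum>k\<le>t. w k / ?W * f (x k))"
    unfolding weighted_avg_as_convex_combination using assms W
    by (intro convex_on_sum[OF _ _ assms(1)])
      (auto simp: less_imp_le simp flip: sum_divide_distrib)
  also have "\<dots> = (\<Sum>k\<le>t. w k * f (x k)) / ?W" by (simp add: sum_divide_distrib)
  finally show ?thesis using W by (simp add: field_simps)
qed

lemma inner_weighted_avg:
  assumes "\<And>k. 0 < (w k :: real)"
  shows "(\<Sum>k\<le>t. w k) * inner (weighted_avg w x t) y = (\<Sum>k\<le>t. w k * inner (x k) y)"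
proof -
  have "0 < (\<Sum>k\<le>t. w k)" using assms by (intro sum_pos) auto
  then show ?thesis by (simp add: weighted_avg_def inner_sum_left)
qed

text \<open>
  Summation by parts leaves \<open>e 0 * a 0\<close> minus terms that are nonnegative because the weights decrease.
\<close>

lemma weighted_telescope_le:
  fixes e a :: "nat \<Rightarrow> real"
  assumes "\<And>k. 0 < e k" "\<And>k. e (Suc k) \<le> e k" "\<And>k. 0 \<le> a k"
  shows "(\<Sum>k\<le>t. e k * (a k - a (Suc k))) \<le> e 0 * a 0"
proof -
  have "(\<Sum>k\<le>t. e k * (a k - a (Suc k))) \<le> e 0 * a 0 - e t * a (Suc t)"
  proof (induction t)
    case (Suc t)
    have "e (Suc t) * a (Suc t) \<le> e t * a (Suc t)"
      using assms by (intro mult_right_mono) auto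
    with Suc show ?case by (simp add: algebra_simps)
  qed (simp add: algebra_simps)
  moreover have "0 \<le> e t * a (Suc t)" using assms by (simp add: less_imp_le)
  ultimately show ?thesis by linarith
qed

section \<open>Ordinary and augmented Lagrangian\<close>

lemma cone_convex_on_imp_convex_on_inner:
  assumes F: "cone_convex_on C U F" and U: "convex U" and y: "y \<in> dual_cone C"
  shows "convex_on U (\<lambda>v. inner y (F v))"
  unfolding convex_on_alt
proof (intro conjI U ballI allI impI)
  fix a b and \<alpha> :: real assume "a \<in> U" "b \<in> U" "0 \<le> \<alpha> \<and> \<alpha> \<le> 1"
  with F have "F (\<alpha> *\<^sub>R a + (1 - \<alpha>) *\<^sub>R b) - \<alpha> *\<^sub>R F a - (1 - \<alpha>) *\<^sub>R F b \<in> uminus ` C"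
    by (auto simp: cone_convex_on_def)
  with y have "inner y (F (\<alpha> *\<^sub>R a + (1 - \<alpha>) *\<^sub>R b) - \<alpha> *\<^sub>R F a - (1 - \<alpha>) *\<^sub>R F b) \<le> 0"
    by (auto simp: dual_cone_def)
  then show "inner y (F (\<alpha> *\<^sub>R a + (1 - \<alpha>) *\<^sub>R b))
      \<le> \<alpha> * inner y (F a) + (1 - \<alpha>) * inner y (F b)"
    by (simp add: inner_diff_right)
qed

text \<open>
  Replacing \<open>\<xi> = 0\<close> by another point of \<open>- C\<close> can only raise the linear term, because the
  multiplier is in the dual cone.
\<close>

lemma lagrangian_le_aug_lagrangian:
  assumes "y \<in> dual_cone C" "0 < \<gamma>"
  shows "lagrangian G J \<Theta> v y \<le> aug_lagrangian C G J \<Theta> \<gamma> v y"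
  unfolding lagrangian_def aug_lagrangian_def
proof (intro INF_greatest add_left_mono)
  fix \<xi> assume "\<xi> \<in> uminus ` C"
  with assms(1) have "inner y \<xi> \<le> 0" by (auto simp: dual_cone_def)
  moreover have "0 \<le> \<gamma> / 2 * (norm (\<Theta> v - \<xi>))\<^sup>2" using assms(2) by simp
  ultimately show "ereal (inner y (\<Theta> v))
      \<le> ereal (inner y (\<Theta> v - \<xi>) + \<gamma> / 2 * (norm (\<Theta> v - \<xi>))\<^sup>2)"
    unfolding ereal_less_eq(3) inner_diff_right by linarith
qed

text \<open>
  By the Moreau decomposition, \<open>\<Theta> v\<close> minus its projection onto the dual cone lies in
  \<open>- C\<close>; this choice of \<open>\<xi>\<close> leaves the projection as the residual \<open>\<Theta> v - \<xi>\<close>.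
\<close>

lemma aug_lagrangian_le_infeasibility:
  fixes C :: "'b::euclidean_space set"
  assumes C: "convex_cone C" "closed C" and "0 < \<gamma>"
    and \<delta>: "norm (closest_point (dual_cone C) (\<Theta> v)) \<le> \<delta>" and r: "norm y \<le> r"
  shows "aug_lagrangian C G J \<Theta> \<gamma> v y
    \<le> ereal (G v) + J v + ereal (r * \<delta> + \<gamma> / 2 * \<delta>\<^sup>2)"
proof -
  let ?z = "closest_point (dual_cone C) (\<Theta> v)"
  have "inner y ?z \<le> norm y * norm ?z" by (rule norm_cauchy_schwarz)
  also have "\<dots> \<le> r * \<delta>" using \<delta> r by (intro mult_mono) (auto intro: order_trans[OF norm_ge_zero])
  finally have 1: "inner y ?z \<le> r * \<delta>" .
  have 2: "\<gamma> / 2 * (norm ?z)\<^sup>2 \<le> \<gamma> / 2 * \<delta>\<^sup>2"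
    using \<delta> \<open>0 < \<gamma>\<close> by (intro mult_left_mono power_mono) auto
  have "\<Theta> v - ?z = - (?z - \<Theta> v)" by simp
  then have "\<Theta> v - ?z \<in> uminus ` C"
    using projection_minus_point_in_cone[OF C] by (metis imageI)
  then have "aug_lagrangian C G J \<Theta> \<gamma> v y \<le> ereal (G v) + J v
      + ereal (inner y (\<Theta> v - (\<Theta> v - ?z)) + \<gamma> / 2 * (norm (\<Theta> v - (\<Theta> v - ?z)))\<^sup>2)"
    unfolding aug_lagrangian_def by (rule INF_lower)
  also have "\<dots> \<le> ereal (G v) + J v + ereal (r * \<delta> + \<gamma> / 2 * \<delta>\<^sup>2)"
    using 1 2 by (intro add_left_mono) simp
  finally show ?thesis .
qed

lemma aug_lagrangian_le_objective_of_feasible: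
  assumes "- \<Theta> v \<in> C"
  shows "aug_lagrangian C G J \<Theta> \<gamma> v y \<le> ereal (G v) + J v"
proof -
  have "\<Theta> v \<in> uminus ` C" using assms by (metis image_eqI minus_minus)
  then have "aug_lagrangian C G J \<Theta> \<gamma> v y \<le> ereal (G v) + J v
      + ereal (inner y (\<Theta> v - \<Theta> v) + \<gamma> / 2 * (norm (\<Theta> v - \<Theta> v))\<^sup>2)"
    unfolding aug_lagrangian_def by (rule INF_lower)
  then show ?thesis by simp
qed

lemma saddle_point_imp_dual_optimal:
  assumes "saddle_point U P L v y"
  shows "is_arg_max (dual_function U L) (\<lambda>y. y \<in> P) y"
  unfolding is_arg_max_def
proof (intro conjI notI)
  show "y \<in> P" using assms by (simp add: saddle_point_def)
  assume "\<exists>z. z \<in> P \<and> dual_function U L y < dual_function U L z"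
  then obtain z where z: "z \<in> P" "dual_function U L y < dual_function U L z" by blast
  have "dual_function U L z \<le> L v z"
    using assms unfolding dual_function_def by (intro INF_lower) (simp add: saddle_point_def)
  also have "\<dots> \<le> L v y" using assms z by (auto simp: saddle_point_def)
  also have "\<dots> \<le> dual_function U L y"
    using assms z unfolding dual_function_def by (intro INF_greatest) (auto simp: saddle_point_def)
  finally show False using z by simp
qed

section \<open>The ergodic primal-dual gap\<close>

text \<open>
  The bound \<open>\<epsilon>_small\<close> is the step size condition in product form, so that no division
  by a possibly vanishing Lipschitz constant occurs.
\<close>

locale vapp_run =
  fixes U :: "'a::euclidean_space set" and C :: "'b::euclidean_space set"
    and G :: "'a \<Rightarrow> real" and J :: "'a \<Rightarrow> ereal" and \<Omega> \<Phi> \<Theta> :: "'a \<Rightarrow> 'b" and K :: "'a \<Rightarrow> real"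
    and \<gamma> B\<^sub>G B\<^sub>\<Omega> \<tau> \<beta> \<epsilon>low :: real and \<epsilon> :: "nat \<Rightarrow> real"
    and u :: "nat \<Rightarrow> 'a" and p :: "nat \<Rightarrow> 'b"
  assumes \<Theta>_eq: "\<Theta> = (\<lambda>v. \<Omega> v + \<Phi> v)"
    and convex_U: "convex U"
    and cone_C: "convex_cone C" "closed C"
    and J_convex: "ext_convex J" and J_proper: "\<exists>v\<in>U. J v < \<infinity>"
    and G_convex: "convex_on U G" and G_diff: "\<And>v. v \<in> U \<Longrightarrow> G differentiable (at v)"
    and G_lip: "B\<^sub>G-lipschitz_on U (gradient G)"
    and \<Omega>_convex: "cone_convex_on C U \<Omega>" and \<Phi>_convex: "cone_convex_on C U \<Phi>"
    and \<Omega>_diff: "\<And>v. v \<in> U \<Longrightarrow> \<Omega> differentiable (at v)"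
    and \<Omega>_lip: "\<And>y. B\<^sub>\<Omega>-lipschitz_on U (gradient (\<lambda>v. inner y (\<Omega> v)))"
    and \<Theta>_lip: "\<tau>-lipschitz_on U \<Theta>"
    and \<beta>_pos: "0 < \<beta>" and K_convex: "strongly_convex_on U \<beta> K"
    and K_diff: "\<And>v. v \<in> U \<Longrightarrow> K differentiable (at v)"
    and \<gamma>_pos: "0 < \<gamma>"
    and \<epsilon>low_pos: "0 < \<epsilon>low" and \<epsilon>_ge: "\<And>k. \<epsilon>low \<le> \<epsilon> k" and \<epsilon>_decr: "\<And>k. \<epsilon> (Suc k) \<le> \<epsilon> k"
    and \<epsilon>_small: "\<And>k. \<epsilon> k * (B\<^sub>G + B\<^sub>\<Omega> + \<gamma> * \<tau>\<^sup>2) \<le> \<beta>"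
    and vapp: "vapp U C G J \<Omega> \<Phi> K \<gamma> \<epsilon> u p"
begin

abbreviation q :: "nat \<Rightarrow> 'b" where "q \<equiv> vapp_q C \<Theta> \<gamma> u p"
abbreviation ubar :: "nat \<Rightarrow> 'a" where "ubar \<equiv> weighted_avg \<epsilon> (\<lambda>k. u (Suc k))"
abbreviation pbar :: "nat \<Rightarrow> 'b" where "pbar \<equiv> weighted_avg \<epsilon> q"

text \<open>
  On \<open>X\<close>, the part of the effective domain of \<open>J\<close> in \<open>U\<close>, the objective and the Lagrangian
  are the real functions \<open>F\<close> and \<open>lag\<close>; elsewhere in \<open>U\<close> both are infinite, so inequalities that
  bound something by them are trivial there.  All estimates are made on \<open>X\<close>.
\<close>

definition X :: "'a set" where "X = {v \<in> U. J v < \<infinity>}"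
definition F :: "'a \<Rightarrow> real" where "F v = G v + real_of_ereal (J v)"
definition lag :: "'a \<Rightarrow> 'b \<Rightarrow> real" where "lag v y = F v + inner y (\<Theta> v)"

lemma inner_\<Theta>: "inner y (\<Theta> v) = inner y (\<Omega> v) + inner y (\<Phi> v)"
  by (simp add: \<Theta>_eq inner_add_right)

lemma X_subset: "X \<subseteq> U"
  by (auto simp: X_def)

lemma \<epsilon>_pos: "0 < \<epsilon> k"
  using \<epsilon>low_pos \<epsilon>_ge[of k] by linarith

lemma J_real: "v \<in> X \<Longrightarrow> J v = ereal (real_of_ereal (J v))"
  using J_convex by (auto simp: X_def ext_convex_def ereal_real)

lemma objective_real: "v \<in> X \<Longrightarrow> ereal (G v) + J v = ereal (F v)"
  by (subst J_real) (simp_all add: F_def)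

lemma lagrangian_real: "v \<in> X \<Longrightarrow> lagrangian G J \<Theta> v y = ereal (lag v y)"
  by (simp add: lagrangian_def objective_real lag_def)

lemma lagrangian_infinite: "v \<in> U \<Longrightarrow> v \<notin> X \<Longrightarrow> lagrangian G J \<Theta> v y = \<infinity>"
  by (simp add: lagrangian_def X_def)

lemma J_real_convex: "convex_on X (\<lambda>v. real_of_ereal (J v))"
proof -
  have *: "\<alpha> *\<^sub>R x + (1 - \<alpha>) *\<^sub>R y \<in> X \<and> real_of_ereal (J (\<alpha> *\<^sub>R x + (1 - \<alpha>) *\<^sub>R y))
      \<le> \<alpha> * real_of_ereal (J x) + (1 - \<alpha>) * real_of_ereal (J y)"
    if xy: "x \<in> X" "y \<in> X" and \<alpha>: "0 \<le> \<alpha> \<and> \<alpha> \<le> 1" for x y \<alpha>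
  proof -
    let ?z = "\<alpha> *\<^sub>R x + (1 - \<alpha>) *\<^sub>R y"
    have "J ?z \<le> ereal \<alpha> * J x + ereal (1 - \<alpha>) * J y"
      using J_convex \<alpha> by (simp add: ext_convex_def)
    also have "\<dots> = ereal (\<alpha> * real_of_ereal (J x) + (1 - \<alpha>) * real_of_ereal (J y))"
      by (subst J_real[OF xy(1)], subst J_real[OF xy(2)]) simp
    finally have le: "J ?z \<le> ereal (\<alpha> * real_of_ereal (J x) + (1 - \<alpha>) * real_of_ereal (J y))" .
    moreover have "?z \<in> U"
      using convex_U xy \<alpha> by (auto simp: convex_alt X_def add.commute)
    ultimately have zX: "?z \<in> X" by (auto simp: X_def)
    with le show ?thesis by (subst (asm) J_real[OF zX]) simp
  qed
  have "convex X"
    unfolding convex_def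
  proof (intro ballI allI impI)
    fix x y and a b :: real
    assume "x \<in> X" "y \<in> X" "0 \<le> a" "0 \<le> b" "a + b = 1"
    with *[of x y a] show "a *\<^sub>R x + b *\<^sub>R y \<in> X"
      by (metis add_diff_cancel_left' le_add_same_cancel1)
  qed
  with * show ?thesis by (simp add: convex_on_alt)
qed

lemma X_convex: "convex X"
  using J_real_convex by (rule convex_on_imp_convex)

lemma lag_convex:
  assumes "y \<in> dual_cone C"
  shows "convex_on X (\<lambda>v. lag v y)"
proof -
  have "convex_on U (\<lambda>v. inner y (\<Omega> v))" "convex_on U (\<lambda>v. inner y (\<Phi> v))"
    using assms cone_convex_on_imp_convex_on_inner[OF _ convex_U] \<Omega>_convex \<Phi>_convex by auto
  then have "convex_on X (\<lambda>v. G v + real_of_ereal (J v) + (inner y (\<Omega> v) + inner y (\<Phi> v)))"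
    using X_subset X_convex G_convex by (intro convex_on_add J_real_convex) (auto intro: convex_on_subset)
  then show ?thesis by (simp add: lag_def F_def inner_\<Theta>)
qed

lemma u_Suc_minimizes:
  assumes "v \<in> U"
  shows "vapp_objective G J \<Omega> \<Phi> K (\<epsilon> k) (u k) (q k) (u (Suc k))
    \<le> vapp_objective G J \<Omega> \<Phi> K (\<epsilon> k) (u k) (q k) v"
  using vapp assms unfolding vapp_def is_arg_min_def \<Theta>_eq by (auto simp: not_less)

lemma vapp_objective_real:
  assumes "v \<in> X" "x \<in> U"
  shows "vapp_objective G J \<Omega> \<Phi> K e x y v
    = ereal (inner (gradient (\<lambda>v. G v + inner y (\<Omega> v)) x) v
        + (real_of_ereal (J v) + inner y (\<Phi> v)) + 1 / e * bregman K v x)"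
proof -
  have "(\<lambda>v. inner y (\<Omega> v)) differentiable (at x)"
    using \<Omega>_diff[OF assms(2)] by (intro differentiable_inner) auto
  from gradient_add[OF G_diff[OF assms(2)] this]
  show ?thesis
    unfolding vapp_objective_def
    by (subst J_real[OF assms(1)])
      (simp add: inner_add_left inner_add_right
        inner_frechet_derivative_eq_gradient[OF \<Omega>_diff[OF assms(2)]])
qed

text \<open>
  Only the iterates from the first step on are known to have a finite objective value: the
  starting point is just required to lie in \<open>U\<close>.
\<close>

lemma u_Suc_in_X: "u (Suc k) \<in> X"
proof -
  obtain v where v: "v \<in> U" "J v < \<infinity>" using J_proper by blast
  have "J (u (Suc k)) \<noteq> \<infinity>"
  proof
    assume "J (u (Suc k)) = \<infinity>"
    then have "vapp_objective G J \<Omega> \<Phi> K (\<epsilon> k) (u k) (q k) (u (Suc k)) = \<infinity>"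
      by (simp add: vapp_objective_def)
    moreover have "vapp_objective G J \<Omega> \<Phi> K (\<epsilon> k) (u k) (q k) v < \<infinity>"
      using v(2) by (simp add: vapp_objective_def)
    ultimately show False using u_Suc_minimizes[OF v(1), of k] by simp
  qed
  moreover have "u (Suc k) \<in> U" using vapp by (simp add: vapp_def is_arg_min_def)
  ultimately show ?thesis by (simp add: X_def)
qed

lemma u_in_U: "u k \<in> U"
proof (cases k)
  case 0
  then show ?thesis using vapp by (simp add: vapp_def)
next
  case (Suc n)
  then show ?thesis using u_Suc_in_X[of n] X_subset by auto
qed

lemma p_Suc: "p (Suc k) = closest_point (dual_cone C) (p k + \<gamma> *\<^sub>R \<Theta> (u (Suc k)))"
  using vapp by (simp add: vapp_def \<Theta>_eq)

lemma q_in_dual_cone: "q k \<in> dual_cone C"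
  unfolding vapp_q_def by (rule projection_in_dual_cone)

lemma bregman_nonneg:
  assumes "x \<in> U" "v \<in> U"
  shows "0 \<le> bregman K v x"
  using strongly_convex_bregman_lower_bound[OF K_convex assms K_diff[OF assms(1)]] \<beta>_pos
  by (meson dual_order.trans divide_nonneg_nonneg less_imp_le mult_nonneg_nonneg zero_le_numeral zero_le_power2)

text \<open>
  The smooth part is \<open>G + \<langle>q\<^sub>k, \<Omega>\<rangle>\<close>, with gradient constant \<open>B\<^sub>G + B\<^sub>\<Omega>\<close>; the part
  \<open>J + \<langle>q\<^sub>k, \<Phi>\<rangle>\<close> is kept exactly.  Both are convex because \<open>q\<^sub>k\<close> is in the dual cone.
\<close>

lemma primal_step:
  assumes v: "v \<in> X"
  shows "\<epsilon> k * (lag (u (Suc k)) (q k) - lag v (q k))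
    \<le> bregman K v (u k) - bregman K v (u (Suc k))
      - (\<beta> - \<epsilon> k * (B\<^sub>G + B\<^sub>\<Omega>)) / 2 * (norm (u (Suc k) - u k))\<^sup>2"
proof -
  let ?f = "\<lambda>v. G v + inner (q k) (\<Omega> v)"
  let ?h = "\<lambda>v. real_of_ereal (J v) + inner (q k) (\<Phi> v)"
  have conv: "convex_on U (\<lambda>v. inner (q k) (\<Omega> v))" "convex_on U (\<lambda>v. inner (q k) (\<Phi> v))"
    using q_in_dual_cone cone_convex_on_imp_convex_on_inner[OF _ convex_U] \<Omega>_convex \<Phi>_convex
    by auto
  have diff: "(\<lambda>v. inner (q k) (\<Omega> v)) differentiable (at w)" if "w \<in> U" for w
    using \<Omega>_diff[OF that] by (intro differentiable_inner) auto
  have lip: "(B\<^sub>G + B\<^sub>\<Omega>)-lipschitz_on U (gradient ?f)"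
  proof (rule lipschitz_on_transform)
    show "(B\<^sub>G + B\<^sub>\<Omega>)-lipschitz_on U (\<lambda>w. gradient G w + gradient (\<lambda>v. inner (q k) (\<Omega> v)) w)"
      by (intro lipschitz_on_add G_lip \<Omega>_lip)
    show "gradient ?f w = gradient G w + gradient (\<lambda>v. inner (q k) (\<Omega> v)) w" if "w \<in> U" for w
      by (rule gradient_add[OF G_diff[OF that] diff[OF that]])
  qed
  have "\<epsilon> k * (?f (u (Suc k)) + ?h (u (Suc k)) - (?f v + ?h v))
      \<le> bregman K v (u k) - bregman K v (u (Suc k))
        - (\<beta> - \<epsilon> k * (B\<^sub>G + B\<^sub>\<Omega>)) / 2 * (norm (u (Suc k) - u k))\<^sup>2"
  proof (rule linearized_bregman_step[where f = ?f and h = ?h, OF X_subset _ _ lip _ K_convex K_diff u_in_U u_Suc_in_X v \<epsilon>_pos])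
    show "convex_on U ?f" using G_convex conv by (intro convex_on_add) auto
    show "convex_on X ?h"
      using X_subset X_convex conv by (intro convex_on_add J_real_convex) (auto intro: convex_on_subset)
    show "?f differentiable (at w)" if "w \<in> U" for w
      by (intro differentiable_add G_diff diff that)
    show "inner (gradient ?f (u k)) (u (Suc k)) + ?h (u (Suc k)) + 1 / \<epsilon> k * bregman K (u (Suc k)) (u k)
        \<le> inner (gradient ?f (u k)) w + ?h w + 1 / \<epsilon> k * bregman K w (u k)" if "w \<in> X" for w
      using u_Suc_minimizes[of w k] that X_subset
      by (auto simp: vapp_objective_real[OF u_Suc_in_X u_in_U] vapp_objective_real[OF that u_in_U])
  qed
  then show ?thesis by (simp add: lag_def F_def inner_\<Theta> algebra_simps)
qed

text \<open>
  The dual step costs \<open>\<epsilon>\<^sub>k \<gamma> \<tau>\<^sup>2/2 \<parallel>u\<^sub>k\<^sub>+\<^sub>1 - u\<^sub>k\<parallel>\<^sup>2\<close>, which the step size condition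
  allows the quadratic gain of the primal step to cover.
\<close>

lemma one_step:
  assumes v: "v \<in> X" and y: "y \<in> dual_cone C"
  shows "\<epsilon> k * (lag (u (Suc k)) y - lag v (q k))
    \<le> bregman K v (u k) - bregman K v (u (Suc k))
      + \<epsilon> k * (1 / (2 * \<gamma>) * (norm (y - p k))\<^sup>2 - 1 / (2 * \<gamma>) * (norm (y - p (Suc k)))\<^sup>2)"
proof -
  let ?n = "(norm (u (Suc k) - u k))\<^sup>2"
  have "norm (\<Theta> (u (Suc k)) - \<Theta> (u k)) \<le> \<tau> * norm (u (Suc k) - u k)"
    using lipschitz_onD[OF \<Theta>_lip u_in_U u_in_U] by (simp add: dist_norm)
  then have "(norm (\<Theta> (u (Suc k)) - \<Theta> (u k)))\<^sup>2 \<le> \<tau>\<^sup>2 * ?n"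
    by (metis norm_ge_zero power_mono power_mult_distrib)
  then have "\<gamma> / 2 * (norm (\<Theta> (u (Suc k)) - \<Theta> (u k)))\<^sup>2 \<le> \<gamma> / 2 * (\<tau>\<^sup>2 * ?n)"
    using \<gamma>_pos by (intro mult_left_mono) auto
  with predictor_corrector_dual_step[OF y \<gamma>_pos vapp_q_def[of C \<Theta> \<gamma> u p k] p_Suc[of k]]
  have "inner (y - q k) (\<Theta> (u (Suc k)))
      \<le> 1 / (2 * \<gamma>) * ((norm (y - p k))\<^sup>2 - (norm (y - p (Suc k)))\<^sup>2) + \<gamma> / 2 * (\<tau>\<^sup>2 * ?n)"
    by linarith
  then have dual: "\<epsilon> k * inner (y - q k) (\<Theta> (u (Suc k)))
      \<le> \<epsilon> k * (1 / (2 * \<gamma>) * ((norm (y - p k))\<^sup>2 - (norm (y - p (Suc k)))\<^sup>2) + \<gamma> / 2 * (\<tau>\<^sup>2 * ?n))"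
    using \<epsilon>_pos by (intro mult_left_mono) (auto simp: less_imp_le)
  have "0 \<le> (\<beta> - \<epsilon> k * (B\<^sub>G + B\<^sub>\<Omega> + \<gamma> * \<tau>\<^sup>2)) / 2 * ?n"
    using \<epsilon>_small by simp
  then have "\<epsilon> k * (\<gamma> / 2 * (\<tau>\<^sup>2 * ?n)) \<le> (\<beta> - \<epsilon> k * (B\<^sub>G + B\<^sub>\<Omega>)) / 2 * ?n"
    by (simp add: field_simps)
  moreover have "\<epsilon> k * (lag (u (Suc k)) y - lag v (q k))
      = \<epsilon> k * (lag (u (Suc k)) (q k) - lag v (q k)) + \<epsilon> k * inner (y - q k) (\<Theta> (u (Suc k)))"
    by (simp add: lag_def inner_diff_left algebra_simps)
  ultimately show ?thesis
    using primal_step[OF v, of k] dual by (simp add: distrib_left right_diff_distrib)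
qed

lemma ubar_in_X: "ubar t \<in> X"
  using weighted_avg_in_convex[OF X_convex \<epsilon>_pos u_Suc_in_X] .

lemma pbar_in_dual_cone: "pbar t \<in> dual_cone C"
  using weighted_avg_in_convex[OF dual_cone_convex \<epsilon>_pos q_in_dual_cone] .

text \<open>
  Sum \<open>one_step\<close> over the iterations.  The constant \<open>c\<close> is nonnegative, so the sum of
  the weights may be replaced by its lower bound \<open>\<epsilon>low (t + 1)\<close>.
\<close>

lemma ergodic_gap:
  assumes v: "v \<in> X" and y: "y \<in> dual_cone C"
    and c: "bregman K v (u 0) + \<epsilon> 0 / (2 * \<gamma>) * (norm (y - p 0))\<^sup>2 \<le> c"
  shows "lag (ubar t) y - lag v (pbar t) \<le> c / (\<epsilon>low * (real t + 1))"
proof -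
  let ?W = "\<Sum>k\<le>t. \<epsilon> k"
  let ?D = "\<lambda>k. bregman K v (u k)" and ?a = "\<lambda>k. 1 / (2 * \<gamma>) * (norm (y - p k))\<^sup>2"
  have "?W * lag (ubar t) y \<le> (\<Sum>k\<le>t. \<epsilon> k * lag (u (Suc k)) y)"
    by (rule convex_on_weighted_avg[OF lag_convex[OF y] \<epsilon>_pos u_Suc_in_X])
  moreover have "?W * lag v (pbar t) = ?W * F v + ?W * inner (pbar t) (\<Theta> v)"
    by (simp only: lag_def distrib_left)
  then have "?W * lag v (pbar t) = (\<Sum>k\<le>t. \<epsilon> k * lag v (q k))"
    unfolding inner_weighted_avg[OF \<epsilon>_pos]
    by (simp add: lag_def distrib_left sum.distrib sum_distrib_right)
  ultimately have "?W * (lag (ubar t) y - lag v (pbar t))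
      \<le> (\<Sum>k\<le>t. \<epsilon> k * (lag (u (Suc k)) y - lag v (q k)))"
    by (simp add: right_diff_distrib sum_subtractf)
  also have "\<dots> \<le> (\<Sum>k\<le>t. 1 * (?D k - ?D (Suc k)) + \<epsilon> k * (?a k - ?a (Suc k)))"
    using one_step[OF v y] by (intro sum_mono) simp
  also have "\<dots> = (\<Sum>k\<le>t. 1 * (?D k - ?D (Suc k))) + (\<Sum>k\<le>t. \<epsilon> k * (?a k - ?a (Suc k)))"
    by (rule sum.distrib)
  also have "\<dots> \<le> 1 * ?D 0 + \<epsilon> 0 * ?a 0"
    using v X_subset \<gamma>_pos
    by (intro add_mono weighted_telescope_le \<epsilon>_pos \<epsilon>_decr bregman_nonneg u_in_U) auto
  also have "\<dots> \<le> c" using c by simp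
  finally have W: "?W * (lag (ubar t) y - lag v (pbar t)) \<le> c" .
  have ge: "\<epsilon>low * (real t + 1) \<le> ?W"
    using sum_bounded_below[of "{..t}" \<epsilon>low \<epsilon>] \<epsilon>_ge by (simp add: algebra_simps)
  have c0: "0 \<le> c"
    using c bregman_nonneg[OF u_in_U[of 0], of v] v X_subset \<epsilon>_pos[of 0] \<gamma>_pos
    by (auto intro!: order_trans[OF _ c] add_nonneg_nonneg)
  have pos: "0 < \<epsilon>low * (real t + 1)" using \<epsilon>low_pos by simp
  then have "lag (ubar t) y - lag v (pbar t) \<le> c / ?W"
    using W ge by (simp add: pos_le_divide_eq mult.commute)
  also have "\<dots> \<le> c / (\<epsilon>low * (real t + 1))"
    using ge pos c0 by (intro divide_left_mono) auto
  finally show ?thesis .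
qed

text \<open>
  The points \<open>q\<^sub>k\<close> and \<open>p\<^sub>k\<^sub>+\<^sub>1\<close> are projections of points at distance
  \<open>\<gamma> \<parallel>\<Theta> u\<^sub>k - \<Theta> u\<^sub>k\<^sub>+\<^sub>1\<parallel> \<le> 2 \<gamma> \<tau> \<mu>\<close>.
\<close>

lemma pbar_bound:
  assumes "\<And>k. norm (u k) \<le> \<mu>" "\<And>k. norm (p k) \<le> \<mu>"
  shows "norm (pbar t) \<le> (1 + 2 * \<gamma> * \<tau>) * \<mu>"
proof -
  have "q k \<in> cball 0 ((1 + 2 * \<gamma> * \<tau>) * \<mu>)" for k
  proof -
    have "norm (q k - p (Suc k)) \<le> norm (\<gamma> *\<^sub>R (\<Theta> (u k) - \<Theta> (u (Suc k))))"
      unfolding vapp_q_def p_Suc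
      by (rule order_trans[OF projection_dual_cone_nonexpansive]) (simp add: scaleR_diff_right)
    also have "\<dots> \<le> \<gamma> * (\<tau> * norm (u k - u (Suc k)))"
      using lipschitz_onD[OF \<Theta>_lip u_in_U u_in_U] \<gamma>_pos
      by (simp add: dist_norm)
    also have "\<dots> \<le> \<gamma> * (\<tau> * (\<mu> + \<mu>))"
      using \<gamma>_pos lipschitz_on_nonneg[OF \<Theta>_lip] norm_triangle_ineq4[of "u k" "u (Suc k)"]
        assms(1)[of k] assms(1)[of "Suc k"]
      by (intro mult_left_mono) auto
    finally have "norm (q k) \<le> \<gamma> * (\<tau> * (\<mu> + \<mu>)) + norm (p (Suc k))"
      using norm_triangle_sub[of "q k" "p (Suc k)"] by linarith
    with assms(2)[of "Suc k"] show ?thesis by (simp add: algebra_simps)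
  qed
  from weighted_avg_in_convex[OF convex_cball \<epsilon>_pos this] show ?thesis by simp
qed

section \<open>Saddle points and the ergodic averages\<close>

context
  fixes us ps
  assumes saddle: "saddle_point U (dual_cone C) (lagrangian G J \<Theta>) us ps"
begin

lemma us_in_X: "us \<in> X"
proof -
  obtain v where v: "v \<in> U" "J v < \<infinity>" using J_proper by blast
  have "us \<in> U" using saddle by (simp add: saddle_point_def)
  have "lagrangian G J \<Theta> us ps \<le> lagrangian G J \<Theta> v ps"
    using saddle v by (auto simp: saddle_point_def)
  also have "\<dots> < \<infinity>" using v by (simp add: lagrangian_def)
  finally show ?thesis using lagrangian_infinite[OF \<open>us \<in> U\<close>] by fastforce
qed

lemma ps_in_dual_cone: "ps \<in> dual_cone C"
  using saddle by (simp add: saddle_point_def)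

lemma saddle_dual_le: "y \<in> dual_cone C \<Longrightarrow> lag us y \<le> lag us ps"
  using saddle us_in_X X_subset by (auto simp: saddle_point_def lagrangian_real)

text \<open>
  Adding a vector \<open>y\<close> of the dual cone to \<open>ps\<close> does not increase the Lagrangian, so
  \<open>\<langle>y, \<Theta> us\<rangle> \<le> 0\<close>; the bipolar theorem applies.
\<close>

lemma saddle_feasible: "- \<Theta> us \<in> C"
proof (rule bipolar_cone[OF cone_C])
  fix y assume "y \<in> dual_cone C"
  with saddle_dual_le[of "ps + y"] ps_in_dual_cone show "0 \<le> inner y (- \<Theta> us)"
    by (simp add: lag_def dual_cone_add inner_add_left)
qed

text \<open>
  Complementary slackness: feasibility gives one inequality, the multiplier \<open>0\<close> the other.
\<close>

lemma saddle_value: "lag us ps = F us"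
proof -
  have "0 \<le> inner ps (- \<Theta> us)"
    using ps_in_dual_cone saddle_feasible by (simp only: dual_cone_def mem_Collect_eq)
  with saddle_dual_le[OF zero_in_dual_cone] show ?thesis by (simp add: lag_def)
qed

lemma saddle_primal_le: "v \<in> X \<Longrightarrow> F us \<le> lag v ps"
  using saddle us_in_X X_subset ps_in_dual_cone unfolding saddle_value[symmetric] saddle_point_def
  by (metis lagrangian_real ereal_less_eq(3) subsetD)

text \<open>
  At the multiplier \<open>ps + sgn z\<close>, where \<open>z\<close> is the projection of \<open>\<Theta> (ubar t)\<close>, the gap is at least
  \<open>\<langle>sgn z, \<Theta> (ubar t)\<rangle> = \<parallel>z\<parallel>\<close>, because \<open>L(us, pbar\<^sub>t) \<le> L(us, ps) \<le> L(ubar\<^sub>t, ps)\<close>.  Since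
  \<open>sgn 0 = 0\<close>, a feasible average is covered as well.
\<close>

lemma infeasibility_le_gap:
  assumes gap: "\<And>y. y \<in> dual_cone C \<Longrightarrow> norm y \<le> norm ps + 1
      \<Longrightarrow> lag (ubar t) y - lag us (pbar t) \<le> \<delta>"
  shows "norm (closest_point (dual_cone C) (\<Theta> (ubar t))) \<le> \<delta>"
proof -
  let ?z = "closest_point (dual_cone C) (\<Theta> (ubar t))"
  have "sgn ?z \<in> dual_cone C"
    unfolding sgn_div_norm by (intro dual_cone_scaleR projection_in_dual_cone) simp
  then have "ps + sgn ?z \<in> dual_cone C" by (intro dual_cone_add ps_in_dual_cone)
  moreover have "norm (ps + sgn ?z) \<le> norm ps + 1"
    using norm_triangle_ineq[of ps "sgn ?z"] by (simp add: norm_sgn split: if_splits)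
  ultimately have "lag (ubar t) (ps + sgn ?z) - lag us (pbar t) \<le> \<delta>" by (rule gap)
  moreover have "lag us (pbar t) \<le> lag (ubar t) ps"
    using saddle_dual_le[OF pbar_in_dual_cone, of t] saddle_primal_le[OF ubar_in_X, of t]
    by (simp add: saddle_value)
  moreover have "inner (sgn ?z) (\<Theta> (ubar t)) = norm ?z"
    by (simp only: sgn_div_norm inner_scaleR_left inner_projection_dual_cone)
      (simp add: power2_eq_square field_simps)
  ultimately show ?thesis by (simp add: lag_def inner_add_left)
qed

text \<open>
  A cluster point of the averages \<open>pbar\<^sub>t\<close> is a dual solution: for fixed \<open>v\<close> the gap at
  \<open>(v, ps)\<close> tends to \<open>0\<close> and \<open>L(v, \<cdot>)\<close> is continuous.  So a dual solution exists within any bound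
  for the averages, even when \<open>ps\<close> exceeds it.
\<close>

lemma bounded_dual_solution:
  assumes r: "\<And>t. norm (pbar t) \<le> r"
  obtains y where "y \<in> dual_cone C" "norm y \<le> r" "\<And>v. v \<in> X \<Longrightarrow> F us \<le> lag v y"
proof -
  have "compact (dual_cone C \<inter> cball 0 r)"
    by (simp add: closed_Int_compact dual_cone_closed)
  moreover have "\<forall>t. pbar t \<in> dual_cone C \<inter> cball 0 r"
    using r pbar_in_dual_cone by simp
  ultimately obtain y s where y: "y \<in> dual_cone C \<inter> cball 0 r" and s: "strict_mono s"
      "(pbar \<circ> s) \<longlonglongrightarrow> y"
    unfolding compact_def by blast
  have "F us \<le> lag v y" if v: "v \<in> X" for v
  proof -
    let ?c = "bregman K v (u 0) + \<epsilon> 0 / (2 * \<gamma>) * (norm (ps - p 0))\<^sup>2"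
    have "(\<lambda>t. ?c / (\<epsilon>low * (real t + 1))) \<longlonglongrightarrow> 0"
    proof -
      have "(\<lambda>t. c / (e * (real t + 1))) \<longlonglongrightarrow> 0" if "0 < e" for c e :: real
        using that by real_asymp
      then show ?thesis using \<epsilon>low_pos by blast
    qed
    from LIMSEQ_subseq_LIMSEQ[OF this s(1)]
    have "(\<lambda>t. lag v (pbar (s t)) + ?c / (\<epsilon>low * (real (s t) + 1))) \<longlonglongrightarrow> lag v y + 0"
      unfolding lag_def using s(2) by (intro tendsto_intros) (auto simp: o_def)
    moreover have "F us \<le> lag v (pbar (s t)) + ?c / (\<epsilon>low * (real (s t) + 1))" for t
      using ergodic_gap[OF v ps_in_dual_cone order_refl, of "s t"] saddle_primal_le[OF ubar_in_X, of "s t"]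
      by linarith
    ultimately show ?thesis by (intro LIMSEQ_le_const) auto
  qed
  with y that show thesis by auto
qed

end

end

section \<open>The convergence rate\<close>

theorem theorem3:
  fixes U :: "(real ^ 'n) set" and C :: "(real ^ 'm) set"
    and G :: "real ^ 'n \<Rightarrow> real" and J :: "real ^ 'n \<Rightarrow> ereal"
    and \<Omega> \<Phi> \<Theta> :: "real ^ 'n \<Rightarrow> real ^ 'm"
    and K :: "real ^ 'n \<Rightarrow> real"
    and L L\<^sub>\<gamma> :: "real ^ 'n \<Rightarrow> real ^ 'm \<Rightarrow> ereal"
    and \<gamma> B\<^sub>G B\<^sub>\<Omega> \<tau> \<beta> B :: real
    and \<epsilon> :: "nat \<Rightarrow> real" and \<epsilon>low \<epsilon>up :: real
    and u :: "nat \<Rightarrow> real ^ 'n" and p q :: "nat \<Rightarrow> real ^ 'm"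
    and us :: "real ^ 'n" and ps :: "real ^ 'm"
    and uhat :: "real ^ 'm \<Rightarrow> real ^ 'n"
    and \<mu> d\<^sub>u M\<^sub>0 r\<^sub>p r\<^sub>u d\<^sub>1 d\<^sub>2 :: real
    and ubar :: "nat \<Rightarrow> real ^ 'n" and pbar :: "nat \<Rightarrow> real ^ 'm"
  assumes U: "U \<noteq> {}" "closed U" "convex U"
    and C: "convex_cone C" "closed C"
    and \<Theta>_def: "\<Theta> = (\<lambda>v. \<Omega> v + \<Phi> v)"
    and L_def: "L = lagrangian G J \<Theta>"
    and L\<gamma>_def: "L\<^sub>\<gamma> = aug_lagrangian C G J \<Theta> \<gamma>"
    \<comment> \<open>standing assumptions on the problem\<close>
    and H1: "ext_convex J" "lsc J" "\<exists>v\<in>U. J v < \<infinity>"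
    and H2: "convex_on UNIV G" "\<forall>v. G differentiable (at v)"
            "B\<^sub>G-lipschitz_on UNIV (gradient G)"
    and H3: "cone_convex_on C U \<Omega>" "cone_convex_on C U \<Phi>"
    and H4: "\<forall>v. \<Omega> differentiable (at v)"
            "\<forall>y. B\<^sub>\<Omega>-lipschitz_on U (gradient (\<lambda>v. inner y (\<Omega> v)))"
    and H5: "\<exists>S. open S \<and> U \<subseteq> S \<and> \<tau>-lipschitz_on S \<Theta>"
    and H6: "interior C \<noteq> {} \<longrightarrow> \<Theta> ` U \<inter> uminus ` interior C \<noteq> {}"
            "C = {0} \<longrightarrow> 0 \<in> interior (\<Theta> ` U)"
    and H7: "\<exists>v y. saddle_point U (dual_cone C) L v y"
    \<comment> \<open>the core function\<close>
    and K: "0 < \<beta>" "strongly_convex_on U \<beta> K" "\<forall>v\<in>U. K differentiable (at v)"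
           "B-lipschitz_on U (gradient K)"
    and coercive: "\<not> bounded U \<longrightarrow>
          (\<forall>w. (\<forall>k. w k \<in> U) \<and> filterlim (\<lambda>k. norm (w k)) at_top sequentially
             \<longrightarrow> (\<lambda>k. ereal (G (w k)) + J (w k)) \<longlonglongrightarrow> \<infinity>)"
    \<comment> \<open>the algorithm; the quotient is taken in the extended reals, where \<open>\<beta> / 0 = \<infinity>\<close>\<close>
    and \<gamma>: "0 < \<gamma>"
    and \<epsilon>: "0 < \<epsilon>low"
            "\<forall>k. \<epsilon>low \<le> \<epsilon> (Suc k) \<and> \<epsilon> (Suc k) \<le> \<epsilon> k \<and> \<epsilon> k \<le> \<epsilon>up"
            "ereal \<epsilon>up < ereal \<beta> / ereal (B\<^sub>G + B\<^sub>\<Omega> + \<gamma> * \<tau>\<^sup>2)"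
    and vapp: "vapp U C G J \<Omega> \<Phi> K \<gamma> \<epsilon> u p"
    and q_def: "q = vapp_q C \<Theta> \<gamma> u p"
    and ubar_def: "ubar = weighted_avg \<epsilon> (\<lambda>k. u (Suc k))"
    and pbar_def: "pbar = weighted_avg \<epsilon> q"
    and saddle: "saddle_point U (dual_cone C) L us ps"
    \<comment> \<open>the constants\<close>
    and \<mu>: "0 < \<mu>" "\<forall>k. norm (u k) \<le> \<mu> \<and> norm (p k) \<le> \<mu>"
    and r\<^sub>p_def: "r\<^sub>p = (1 + 2 * \<gamma> * \<tau>) * \<mu>"
    and d\<^sub>u: "0 < d\<^sub>u"
    and uhat: "\<forall>y\<in>cball 0 r\<^sub>p. is_arg_min (\<lambda>v. L\<^sub>\<gamma> v y) (\<lambda>v. v \<in> U) (uhat y)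
                 \<and> norm (uhat y) \<le> d\<^sub>u"
    and r\<^sub>u_def: "r\<^sub>u = max \<mu> d\<^sub>u"
    and M\<^sub>0: "\<forall>y. is_arg_max (dual_function U L) (\<lambda>y. y \<in> dual_cone C) y \<longrightarrow> norm y \<le> M\<^sub>0"
    and d\<^sub>1_def: "d\<^sub>1 = (SUP y\<in>cball 0 (M\<^sub>0 + 1).
                   bregman K us (u 0) + \<epsilon> 0 / (2 * \<gamma>) * (norm (y - p 0))\<^sup>2)"
    and d\<^sub>2_def: "d\<^sub>2 = (SUP (v, y)\<in>(U \<inter> cball 0 r\<^sub>u) \<times> (dual_cone C \<inter> cball 0 r\<^sub>p).
                   bregman K v (u 0) + \<epsilon> 0 / (2 * \<gamma>) * (norm (y - p 0))\<^sup>2)"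
  shows "\<forall>t::nat.
     (ubar t, pbar t) \<in> (U \<inter> cball 0 r\<^sub>u) \<times> (dual_cone C \<inter> cball 0 r\<^sub>p)
   \<and> uhat (pbar t) \<in> U \<inter> cball 0 r\<^sub>u
   \<and> (\<forall>(v, y)\<in>(U \<inter> cball 0 r\<^sub>u) \<times> (dual_cone C \<inter> cball 0 r\<^sub>p).
        ereal (- (d\<^sub>2 / (\<epsilon>low * (real t + 1)))) + L (ubar t) y \<le> L (ubar t) (pbar t)
      \<and> L (ubar t) (pbar t) \<le> L v (pbar t) + ereal (d\<^sub>2 / (\<epsilon>low * (real t + 1))))
   \<and> (\<forall>(v, y)\<in>(U \<inter> cball 0 r\<^sub>u) \<times> (dual_cone C \<inter> cball 0 r\<^sub>p).
        ereal (- ((r\<^sub>p * d\<^sub>1 + d\<^sub>2) / (\<epsilon>low * (real t + 1)))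
               - \<gamma> * d\<^sub>1\<^sup>2 / (2 * \<epsilon>low\<^sup>2 * (real t + 1)\<^sup>2)) + L\<^sub>\<gamma> (ubar t) y
          \<le> L\<^sub>\<gamma> (ubar t) (pbar t)
      \<and> L\<^sub>\<gamma> (ubar t) (pbar t)
          \<le> L\<^sub>\<gamma> v (pbar t)
             + ereal ((r\<^sub>p * d\<^sub>1 + 2 * d\<^sub>2) / (\<epsilon>low * (real t + 1))
                      + \<gamma> * d\<^sub>1\<^sup>2 / (2 * \<epsilon>low\<^sup>2 * (real t + 1)\<^sup>2)))
   \<and> dual_function U L\<^sub>\<gamma> ps
       \<le> dual_function U L\<^sub>\<gamma> (pbar t)
          + ereal ((2 * r\<^sub>p * d\<^sub>1 + 3 * d\<^sub>2) / (\<epsilon>low * (real t + 1))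
                   + \<gamma> * d\<^sub>1\<^sup>2 / (\<epsilon>low\<^sup>2 * (real t + 1)\<^sup>2))"
proof (intro allI, goal_cases)
  case (1 t)
  obtain S where S: "U \<subseteq> S" "\<tau>-lipschitz_on S \<Theta>" using H5 by blast
  then have \<Theta>_lip: "\<tau>-lipschitz_on U \<Theta>" by (metis lipschitz_on_subset)
  have \<epsilon>_ge: "\<epsilon>low \<le> \<epsilon> k" for k
    using \<epsilon>(2) by (cases k) (auto intro: order_trans)
  have \<epsilon>_small: "\<epsilon> k * (B\<^sub>G + B\<^sub>\<Omega> + \<gamma> * \<tau>\<^sup>2) \<le> \<beta>" for k
  proof -
    let ?M = "B\<^sub>G + B\<^sub>\<Omega> + \<gamma> * \<tau>\<^sup>2"
    have "0 \<le> ?M"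
      using lipschitz_on_nonneg[OF H2(3)] lipschitz_on_nonneg[of B\<^sub>\<Omega>] H4(2) \<gamma> by fastforce
    \<comment> \<open>If all Lipschitz constants vanish, the quotient in the hypothesis is infinite and says nothing.\<close>
    show ?thesis
    proof (cases "?M = 0")
      case False
      with \<open>0 \<le> ?M\<close> have M: "0 < ?M" by simp
      with \<epsilon>(3) have "\<epsilon>up * ?M < \<beta>" by (simp add: pos_less_divide_eq)
      moreover have "\<epsilon> k * ?M \<le> \<epsilon>up * ?M" using M \<epsilon>(2) by (intro mult_right_mono) auto
      ultimately show ?thesis by linarith
    qed (use K(1) in simp)
  qed
  interpret run: vapp_run U C G J \<Omega> \<Phi> \<Theta> K \<gamma> B\<^sub>G B\<^sub>\<Omega> \<tau> \<beta> \<epsilon>low \<epsilon> u p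
  proof
    show "convex_on U G" using H2(1) U(3) by (meson convex_on_subset subset_UNIV)
    show "B\<^sub>G-lipschitz_on U (gradient G)" using H2(3) by (meson lipschitz_on_subset subset_UNIV)
    show "\<exists>v\<in>U. J v < \<infinity>" by (rule H1(3))
    show "\<epsilon> (Suc k) \<le> \<epsilon> k" for k using \<epsilon>(2) by blast
  qed (use U C H1 H2 H3 H4 K \<gamma> \<epsilon>(1) \<epsilon>_ge \<epsilon>_small \<Theta>_def \<Theta>_lip vapp in auto)
  have ubar_eq: "ubar = run.ubar" and pbar_eq: "pbar = run.pbar"
    by (simp_all add: ubar_def pbar_def q_def)
  have sad: "saddle_point U (dual_cone C) (lagrangian G J \<Theta>) us ps"
    using saddle by (simp add: L_def)

  have r\<^sub>p_nonneg: "0 \<le> r\<^sub>p"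
    using lipschitz_on_nonneg[OF \<Theta>_lip] \<gamma> \<mu>(1) by (simp add: r\<^sub>p_def)
  have ubarX: "ubar k \<in> run.X" for k
    unfolding ubar_eq by (rule run.ubar_in_X)
  have "ubar t \<in> cball 0 \<mu>"
    unfolding ubar_eq using \<mu>(2) by (intro weighted_avg_in_convex run.\<epsilon>_pos) auto
  then have ubar_in: "ubar t \<in> U \<inter> cball 0 r\<^sub>u"
    using ubarX run.X_subset by (auto simp: r\<^sub>u_def)
  have pbar_norm: "norm (pbar k) \<le> r\<^sub>p" for k
    unfolding pbar_eq r\<^sub>p_def using \<mu>(2) by (intro run.pbar_bound) auto
  have pbar_in: "pbar t \<in> dual_cone C \<inter> cball 0 r\<^sub>p"
    using run.pbar_in_dual_cone pbar_norm by (simp add: pbar_eq)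
  have uhat_min: "is_arg_min (\<lambda>v. L\<^sub>\<gamma> v (pbar t)) (\<lambda>v. v \<in> U) (uhat (pbar t))"
    and uhat_in: "uhat (pbar t) \<in> U \<inter> cball 0 r\<^sub>u"
    using bspec[OF uhat, of "pbar t"] pbar_in
    by (auto simp: is_arg_min_def r\<^sub>u_def le_max_iff_disj)

  define \<Delta> where "\<Delta> v y = bregman K v (u 0) + \<epsilon> 0 / (2 * \<gamma>) * (norm (y - p 0))\<^sup>2" for v y
  have \<Delta>_nonneg: "0 \<le> \<Delta> v y" if "v \<in> U" for v y
    using run.bregman_nonneg[OF run.u_in_U that, of 0] run.\<epsilon>_pos[of 0] \<gamma> by (simp add: \<Delta>_def)
  have K_cont: "continuous_on U K"
    using K(3) by (intro continuous_at_imp_continuous_on) (auto intro: differentiable_imp_continuous_within)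
  \<comment> \<open>The values \<open>d\<^sub>1\<close> and \<open>d\<^sub>2\<close> are suprema of reals; they bound \<open>\<Delta>\<close> because compactness bounds it.\<close>
  have d\<^sub>1: "\<Delta> us y \<le> d\<^sub>1" if "norm y \<le> M\<^sub>0 + 1" for y
  proof -
    have "compact (\<Delta> us ` cball 0 (M\<^sub>0 + 1))"
      unfolding \<Delta>_def by (intro compact_continuous_image continuous_intros) auto
    then show ?thesis
      unfolding d\<^sub>1_def using that
      by (fold \<Delta>_def) (auto intro!: cSUP_upper bounded_imp_bdd_above compact_imp_bounded)
  qed
  have d\<^sub>2: "\<Delta> v y \<le> d\<^sub>2"
    if "v \<in> U \<inter> cball 0 r\<^sub>u" "y \<in> dual_cone C \<inter> cball 0 r\<^sub>p" for v y
  proof -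
    let ?A = "(U \<inter> cball 0 r\<^sub>u) \<times> (dual_cone C \<inter> cball 0 r\<^sub>p)"
    have "continuous_on ?A (\<lambda>z. K (fst z))"
      by (rule continuous_on_compose2[OF K_cont]) (auto intro!: continuous_intros)
    then have "continuous_on ?A (\<lambda>(v, y). \<Delta> v y)"
      unfolding \<Delta>_def bregman_def split_beta by (intro continuous_intros)
    moreover have "compact ?A"
      using U(2) by (intro compact_Times closed_Int_compact dual_cone_closed) auto
    ultimately have "bdd_above ((\<lambda>(v, y). \<Delta> v y) ` ?A)"
      by (intro bounded_imp_bdd_above compact_imp_bounded compact_continuous_image)
    from cSUP_upper[OF _ this, of "(v, y)"] that show ?thesis
      by (simp add: d\<^sub>2_def \<Delta>_def)
  qed

  define a where "a = d\<^sub>1 / (\<epsilon>low * (real t + 1))"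
  define b where "b = d\<^sub>2 / (\<epsilon>low * (real t + 1))"
  define c where "c = r\<^sub>p * a + \<gamma> / 2 * a\<^sup>2"
  have M\<^sub>0_ge: "norm ps \<le> M\<^sub>0"
    using M\<^sub>0 saddle_point_imp_dual_optimal[OF saddle] by blast
  have "0 \<le> d\<^sub>1"
    using \<Delta>_nonneg[of us 0] d\<^sub>1[of 0] run.us_in_X[OF sad] run.X_subset M\<^sub>0_ge norm_ge_zero[of ps]
    by (auto simp del: norm_ge_zero)
  then have a: "0 \<le> a" using \<epsilon>(1) by (simp add: a_def)
  have "0 \<le> d\<^sub>2"
    using \<Delta>_nonneg[of "ubar t" "pbar t"] d\<^sub>2[OF ubar_in pbar_in] ubar_in by auto
  then have b: "0 \<le> b" using \<epsilon>(1) by (simp add: b_def)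
  have c: "0 \<le> c" using a r\<^sub>p_nonneg \<gamma> by (simp add: c_def)

  have L_real: "L v y = ereal (run.lag v y)" if "v \<in> run.X" for v y
    unfolding L_def by (rule run.lagrangian_real[OF that])
  have gap: "L (ubar t) y \<le> L v (pbar t) + ereal b"
    if v: "v \<in> U \<inter> cball 0 r\<^sub>u" and y: "y \<in> dual_cone C \<inter> cball 0 r\<^sub>p" for v y
  proof (cases "v \<in> run.X")
    case True
    have "run.lag (ubar t) y - run.lag v (pbar t) \<le> b"
      unfolding ubar_eq pbar_eq b_def
      using d\<^sub>2[OF v y] y by (intro run.ergodic_gap[OF True]) (auto simp: \<Delta>_def)
    then show ?thesis by (simp add: L_real True ubarX)
  next
    case False
    with v show ?thesis by (simp add: L_def run.lagrangian_infinite)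
  qed
  have infeas: "norm (closest_point (dual_cone C) (\<Theta> (ubar t))) \<le> a"
    unfolding ubar_eq
  proof (rule run.infeasibility_le_gap[OF sad])
    fix y assume y: "y \<in> dual_cone C" "norm y \<le> norm ps + 1"
    with M\<^sub>0_ge have "\<Delta> us y \<le> d\<^sub>1" by (intro d\<^sub>1) simp
    then show "run.lag (run.ubar t) y - run.lag us (run.pbar t) \<le> a"
      unfolding a_def \<Delta>_def by (rule run.ergodic_gap[OF run.us_in_X[OF sad] y(1)])
  qed

  have L_le_L\<gamma>: "L v y \<le> L\<^sub>\<gamma> v y" if "y \<in> dual_cone C" for v y
    unfolding L_def L\<gamma>_def by (rule lagrangian_le_aug_lagrangian[OF that \<gamma>])
  \<comment> \<open>The multiplier \<open>0\<close> turns the Lagrangian into the objective.\<close>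
  have "L (ubar t) 0 \<le> L (ubar t) (pbar t) + ereal b"
    using r\<^sub>p_nonneg by (intro gap ubar_in) (simp add: zero_in_dual_cone)
  then have F_le: "run.F (ubar t) \<le> run.lag (ubar t) (pbar t) + b"
    by (simp add: L_real ubarX run.lag_def)
  have L\<gamma>_le: "L\<^sub>\<gamma> (ubar t) y \<le> ereal (run.lag (ubar t) (pbar t) + (b + c))"
    if "norm y \<le> r\<^sub>p" for y
  proof -
    have "L\<^sub>\<gamma> (ubar t) y \<le> ereal (G (ubar t)) + J (ubar t) + ereal c"
      unfolding L\<gamma>_def c_def by (rule aug_lagrangian_le_infeasibility[where \<Theta> = \<Theta> and v = "ubar t", OF C \<gamma> infeas that])
    also have "\<dots> = ereal (run.F (ubar t) + c)"
      by (simp add: run.objective_real ubarX)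
    finally show ?thesis using F_le by (auto intro: order_trans)
  qed

  have i: "ereal (- b) + L (ubar t) y \<le> L (ubar t) (pbar t)
      \<and> L (ubar t) (pbar t) \<le> L v (pbar t) + ereal b"
    if "v \<in> U \<inter> cball 0 r\<^sub>u" "y \<in> dual_cone C \<inter> cball 0 r\<^sub>p" for v y
    using gap[OF ubar_in that(2)] gap[OF that(1) pbar_in] by (simp add: L_real ubarX)
  have ii: "ereal (- (b + c)) + L\<^sub>\<gamma> (ubar t) y \<le> L\<^sub>\<gamma> (ubar t) (pbar t)
      \<and> L\<^sub>\<gamma> (ubar t) (pbar t) \<le> L\<^sub>\<gamma> v (pbar t) + ereal (2 * b + c)"
    if v: "v \<in> U \<inter> cball 0 r\<^sub>u" and y: "y \<in> dual_cone C \<inter> cball 0 r\<^sub>p" for v y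
  proof
    have "ereal (- (b + c)) + L\<^sub>\<gamma> (ubar t) y
        \<le> ereal (- (b + c)) + ereal (run.lag (ubar t) (pbar t) + (b + c))"
      using y by (intro add_left_mono L\<gamma>_le) simp
    also have "\<dots> = L (ubar t) (pbar t)" by (simp add: L_real ubarX)
    also have "\<dots> \<le> L\<^sub>\<gamma> (ubar t) (pbar t)" using pbar_in by (intro L_le_L\<gamma>) simp
    finally show "ereal (- (b + c)) + L\<^sub>\<gamma> (ubar t) y \<le> L\<^sub>\<gamma> (ubar t) (pbar t)" .
    have "L\<^sub>\<gamma> (ubar t) (pbar t) \<le> L (ubar t) (pbar t) + ereal (b + c)"
      using L\<gamma>_le[OF pbar_norm] by (simp add: L_real ubarX)
    also have "\<dots> \<le> (L v (pbar t) + ereal b) + ereal (b + c)"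
      by (intro add_right_mono gap v pbar_in)
    also have "\<dots> = L v (pbar t) + ereal (2 * b + c)"
      by (simp add: add.assoc)
    also have "\<dots> \<le> L\<^sub>\<gamma> v (pbar t) + ereal (2 * b + c)"
      using pbar_in by (intro add_right_mono L_le_L\<gamma>) simp
    finally show "L\<^sub>\<gamma> (ubar t) (pbar t) \<le> L\<^sub>\<gamma> v (pbar t) + ereal (2 * b + c)" .
  qed
  have iii: "dual_function U L\<^sub>\<gamma> ps \<le> dual_function U L\<^sub>\<gamma> (pbar t) + ereal (2 * c + 3 * b)"
  proof -
    obtain y where y: "y \<in> dual_cone C" "norm y \<le> r\<^sub>p"
        and opt: "\<And>v. v \<in> run.X \<Longrightarrow> run.F us \<le> run.lag v y"
      using run.bounded_dual_solution[OF sad, of r\<^sub>p] pbar_norm unfolding pbar_eq by blast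
    have "dual_function U L\<^sub>\<gamma> ps \<le> L\<^sub>\<gamma> us ps"
      unfolding dual_function_def using run.us_in_X[OF sad] run.X_subset by (intro INF_lower) auto
    also have "\<dots> \<le> ereal (run.F us)"
      unfolding L\<gamma>_def run.objective_real[OF run.us_in_X[OF sad], symmetric]
      by (rule aug_lagrangian_le_objective_of_feasible[where \<Theta> = \<Theta> and v = us, OF run.saddle_feasible[OF sad]])
    also have "\<dots> \<le> L (ubar t) y"
      using opt[OF ubarX] by (simp add: L_real ubarX)
    also have "\<dots> \<le> L (uhat (pbar t)) (pbar t) + ereal b"
      using y by (intro gap uhat_in) simp
    also have "\<dots> \<le> L\<^sub>\<gamma> (uhat (pbar t)) (pbar t) + ereal (2 * c + 3 * b)"
      using pbar_in b c by (intro add_mono L_le_L\<gamma>) auto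
    also have "L\<^sub>\<gamma> (uhat (pbar t)) (pbar t) \<le> dual_function U L\<^sub>\<gamma> (pbar t)"
      unfolding dual_function_def using uhat_min
      by (intro INF_greatest) (auto simp: is_arg_min_def not_less)
    finally show ?thesis by (simp add: add_right_mono)
  qed

  have "- ((r\<^sub>p * d\<^sub>1 + d\<^sub>2) / (\<epsilon>low * (real t + 1)))
      - \<gamma> * d\<^sub>1\<^sup>2 / (2 * \<epsilon>low\<^sup>2 * (real t + 1)\<^sup>2) = - (b + c)"
    "(r\<^sub>p * d\<^sub>1 + 2 * d\<^sub>2) / (\<epsilon>low * (real t + 1))
      + \<gamma> * d\<^sub>1\<^sup>2 / (2 * \<epsilon>low\<^sup>2 * (real t + 1)\<^sup>2) = 2 * b + c"
    "(2 * r\<^sub>p * d\<^sub>1 + 3 * d\<^sub>2) / (\<epsilon>low * (real t + 1))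
      + \<gamma> * d\<^sub>1\<^sup>2 / (\<epsilon>low\<^sup>2 * (real t + 1)\<^sup>2) = 2 * c + 3 * b"
    unfolding a_def b_def c_def by (simp_all add: add_divide_distrib power_divide power_mult_distrib)
  then show ?case
    using ubar_in pbar_in uhat_in i ii iii by (simp add: b_def)
qed

end
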